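(* Assume $\lambda_A>0$, that $\|\theta^*\|_2\le R$, and the geometric ergodicity assumption: there are constants $\kappa_0>0$ and $\rho\in(0,1)$ with $\sup_{s\in\mathcal S}d_{TV}(\mathbb P(s_t\in\cdot\mid s_0=s),\mu)\le\kappa_0\rho^t$ for all $t\ge0$. Run projected TD-SVRG with Markovian sampling (Algorithm 4) with step size $\alpha>0$ and inner-loop length $M$ satisfying $\alpha M\lambda_A=2$, and with the same estimation trajectory length $n$ in every epoch. Then for every $m\ge0$, $$\mathbb E[f_e(\tilde\theta_m)]\le\left(\tfrac34\right)^m f_e(\tilde\theta_0)+\frac{8C_2}{\lambda_A n}+4\alpha\Big(2G^2\big(4+6\tau^{\rm mix}(\alpha)\big)+9R^2\Big),$$ where $C_2=\frac{4(1+(\kappa_0-1)\rho)}{1-\rho}\,[4R^2+r_{\max}^2]$, $r_{\max}=\max_{s,s'}|r(s,s')|$, $G=r_{\max}+2R$, and $\tau^{\rm mix}(\alpha)=\min\{t\ge0:\kappa_0\rho^t\le\alpha\}$.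
   Context: Environment setting. Let $\mathcal S$ be a finite state space, $P$ an irreducible aperiodic transition matrix on $\mathcal S$ (induced by a fixed policy) with stationary distribution $\mu$, $\phi:\mathcal S\to\mathbb R^d$ a feature map with $\|\phi(s)\|_2\le1$ for all $s$, $r:\mathcal S\times\mathcal S\to\mathbb R$ a reward function and $\gamma\in[0,1)$. For states $s,s'$ and $\theta\in\mathbb R^d$ let $g_{s,s'}(\theta)=(r(s,s')+\gamma\phi(s')^T\theta-\phi(s)^T\theta)\phi(s)$. Let $A_e=\sum_{s,s'}\mu(s)P(s,s')\phi(s)(\phi(s)-\gamma\phi(s'))^T$ and $b_e=\sum_{s,s'}\mu(s)P(s,s')r(s,s')\phi(s)$; assume $A_e$ is nonsingular and let $\theta^*=A_e^{-1}b_e$. Let $\lambda_A$ be the minimum eigenvalue of $(A_e+A_e^T)/2$. Define $f_e(\theta)=(\theta-\theta^* )^TA_e(\theta-\theta^* )$. Let $\Pi_R(\theta)=\arg\min_{\|\theta'\|_2\le R}\|\theta-\theta'\|_2$ be Euclidean projection onto the ball of radius $R$. Algorithm 4 (TD-SVRG, Markovian sampling): a single Markov chain $s_0,s_1,\dots$ with transition matrix $P$ is run and all transitions used are consecutive pairs of this chain, taken in order. Given $\alpha>0$, integer $M\ge1$, estimation length $n$ and initial $\tilde\theta_0$ with $\|\tilde\theta_0\|\le R$, for epochs $m=1,2,\dots$: set $\tilde\theta=\tilde\theta_{m-1}$; take the next $n$ transitions of the chain as $\mathcal D^m$ and compute $g_m(\tilde\theta)=\frac1n\sum_{(s,s')\in\mathcal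 D^m}g_{s,s'}(\tilde\theta)$; set $\theta_0=\tilde\theta$; for $t=1,\dots,M$ take the next transition $(s,s')$ of the chain, put $v_t=g_{s,s'}(\theta_{t-1})-g_{s,s'}(\tilde\theta)+g_m(\tilde\theta)$ and $\theta_t=\Pi_R(\theta_{t-1}+\alpha v_t)$; finally set $\tilde\theta_m=\theta_{t'}$ with $t'$ uniform on $\{0,\dots,M-1\}$, independent. *)

theory Defs
  imports "HOL-Analysis.Analysis" "HOL-Probability.Probability_Mass_Function"
begin

text \<open>The transition matrix P is given as a kernel K, with P(s,s') = pmf (K s) s'.
  Distribution of s_t given s_0 = s.\<close>
fun chain_dist :: "('s \<Rightarrow> 's pmf) \<Rightarrow> nat \<Rightarrow> 's \<Rightarrow> 's pmf" where
  "chain_dist K 0 s = return_pmf s"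
| "chain_dist K (Suc t) s = bind_pmf (chain_dist K t s) K"

definition irreducible_chain :: "('s \<Rightarrow> 's pmf) \<Rightarrow> bool" where
  "irreducible_chain K \<longleftrightarrow> (\<forall>s s'. \<exists>t. pmf (chain_dist K t s) s' > 0)"

definition aperiodic_chain :: "('s \<Rightarrow> 's pmf) \<Rightarrow> bool" where
  "aperiodic_chain K \<longleftrightarrow> (\<forall>s. Gcd {t. t > 0 \<and> pmf (chain_dist K t s) s > 0} = (1::nat))"

definition stationary_dist :: "('s \<Rightarrow> 's pmf) \<Rightarrow> 's pmf \<Rightarrow> bool" where
  "stationary_dist K \<mu> \<longleftrightarrow> bind_pmf \<mu> K = \<mu>"

definition tv_dist :: "'s pmf \<Rightarrow> 's pmf \<Rightarrow> real" where
  "tv_dist p q = (SUP A. \<bar>measure_pmf.prob p A - measure_pmf.prob q A\<bar>)"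

definition outer :: "real^'d \<Rightarrow> real^'d \<Rightarrow> real^'d^'d" where
  "outer u v = (\<chi> i j. u $ i * v $ j)"

definition is_eigenvalue :: "real^'d^'d \<Rightarrow> real \<Rightarrow> bool" where
  "is_eigenvalue S l \<longleftrightarrow> (\<exists>v. v \<noteq> 0 \<and> S *v v = l *s v)"

definition min_eigenvalue :: "real^'d^'d \<Rightarrow> real" where
  "min_eigenvalue S = Min {l. is_eigenvalue S l}"

definition A_e :: "('s::finite \<Rightarrow> 's pmf) \<Rightarrow> 's pmf \<Rightarrow> ('s \<Rightarrow> real^'d) \<Rightarrow> real \<Rightarrow> real^'d^'d" where
  "A_e K \<mu> \<phi> \<gamma> = (\<Sum>s\<in>UNIV. \<Sum>s'\<in>UNIV.
      (pmf \<mu> s * pmf (K s) s') *\<^sub>R outer (\<phi> s) (\<phi> s - \<gamma> *\<^sub>R \<phi> s'))"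

definition b_e :: "('s::finite \<Rightarrow> 's pmf) \<Rightarrow> 's pmf \<Rightarrow> ('s \<Rightarrow> real^'d) \<Rightarrow> ('s \<Rightarrow> 's \<Rightarrow> real) \<Rightarrow> real^'d" where
  "b_e K \<mu> \<phi> r = (\<Sum>s\<in>UNIV. \<Sum>s'\<in>UNIV. (pmf \<mu> s * pmf (K s) s' * r s s') *\<^sub>R \<phi> s)"

definition theta_star :: "('s::finite \<Rightarrow> 's pmf) \<Rightarrow> 's pmf \<Rightarrow> ('s \<Rightarrow> real^'d) \<Rightarrow> ('s \<Rightarrow> 's \<Rightarrow> real) \<Rightarrow> real \<Rightarrow> real^'d" where
  "theta_star K \<mu> \<phi> r \<gamma> = matrix_inv (A_e K \<mu> \<phi> \<gamma>) *v b_e K \<mu> \<phi> r"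

definition lambda_A :: "('s::finite \<Rightarrow> 's pmf) \<Rightarrow> 's pmf \<Rightarrow> ('s \<Rightarrow> real^'d) \<Rightarrow> real \<Rightarrow> real" where
  "lambda_A K \<mu> \<phi> \<gamma> =
     min_eigenvalue ((1/2) *\<^sub>R (A_e K \<mu> \<phi> \<gamma> + transpose (A_e K \<mu> \<phi> \<gamma>)))"

definition f_e :: "('s::finite \<Rightarrow> 's pmf) \<Rightarrow> 's pmf \<Rightarrow> ('s \<Rightarrow> real^'d) \<Rightarrow> ('s \<Rightarrow> 's \<Rightarrow> real) \<Rightarrow> real \<Rightarrow> real^'d \<Rightarrow> real" where
  "f_e K \<mu> \<phi> r \<gamma> \<theta> =
     (let d = \<theta> - theta_star K \<mu> \<phi> r \<gamma> in d \<bullet> (A_e K \<mu> \<phi> \<gamma> *v d))"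

definition td_g :: "('s \<Rightarrow> 's \<Rightarrow> real) \<Rightarrow> real \<Rightarrow> ('s \<Rightarrow> real^'d) \<Rightarrow> 's \<Rightarrow> 's \<Rightarrow> real^'d \<Rightarrow> real^'d" where
  "td_g r \<gamma> \<phi> s s' \<theta> = (r s s' + \<gamma> * (\<phi> s' \<bullet> \<theta>) - \<phi> s \<bullet> \<theta>) *\<^sub>R \<phi> s"

definition proj_ball :: "real \<Rightarrow> real^'d \<Rightarrow> real^'d" where
  "proj_ball R \<theta> = closest_point (cball 0 R) \<theta>"

fun td_est :: "('s \<Rightarrow> 's pmf) \<Rightarrow> ('s \<Rightarrow> 's \<Rightarrow> real) \<Rightarrow> real \<Rightarrow> ('s \<Rightarrow> real^'d)
     \<Rightarrow> real^'d \<Rightarrow> nat \<Rightarrow> 's \<Rightarrow> ((real^'d) \<times> 's) pmf" where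
  "td_est K r \<gamma> \<phi> \<theta> 0 s = return_pmf (0, s)"
| "td_est K r \<gamma> \<phi> \<theta> (Suc k) s =
     bind_pmf (K s) (\<lambda>s'. map_pmf (\<lambda>(acc, sl). (td_g r \<gamma> \<phi> s s' \<theta> + acc, sl))
                                   (td_est K r \<gamma> \<phi> \<theta> k s'))"

text \<open>Inner loop: k remaining iterations starting at chain state s with current iterate theta;
  snapshot thetat, full gradient estimate gm. Returns the list of iterates
  [theta_current, ...] (of length k, i.e. theta_0..theta_{M-1} when k = M) and last chain state.\<close>
fun td_inner :: "('s \<Rightarrow> 's pmf) \<Rightarrow> ('s \<Rightarrow> 's \<Rightarrow> real) \<Rightarrow> real \<Rightarrow> ('s \<Rightarrow> real^'d)
     \<Rightarrow> real \<Rightarrow> real \<Rightarrow> real^'d \<Rightarrow> real^'d \<Rightarrow> nat \<Rightarrow> 's \<Rightarrow> real^'d \<Rightarrow> ((real^'d) list \<times> 's) pmf" where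
  "td_inner K r \<gamma> \<phi> R \<alpha> \<theta>t gm 0 s \<theta> = return_pmf ([], s)"
| "td_inner K r \<gamma> \<phi> R \<alpha> \<theta>t gm (Suc k) s \<theta> =
     bind_pmf (K s) (\<lambda>s'.
       let v = td_g r \<gamma> \<phi> s s' \<theta> - td_g r \<gamma> \<phi> s s' \<theta>t + gm;
           \<theta>' = proj_ball R (\<theta> + \<alpha> *\<^sub>R v)
       in map_pmf (\<lambda>(ths, sl). (\<theta> # ths, sl)) (td_inner K r \<gamma> \<phi> R \<alpha> \<theta>t gm k s' \<theta>'))"

definition td_epoch :: "('s \<Rightarrow> 's pmf) \<Rightarrow> ('s \<Rightarrow> 's \<Rightarrow> real) \<Rightarrow> real \<Rightarrow> ('s \<Rightarrow> real^'d)
     \<Rightarrow> real \<Rightarrow> real \<Rightarrow> nat \<Rightarrow> nat \<Rightarrow> 's \<times> (real^'d) \<Rightarrow> ('s \<times> (real^'d)) pmf" where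
  "td_epoch K r \<gamma> \<phi> R \<alpha> M n = (\<lambda>(s, \<theta>t).
     bind_pmf (td_est K r \<gamma> \<phi> \<theta>t n s) (\<lambda>(acc, s1).
       let gm = (1 / real n) *\<^sub>R acc in
       bind_pmf (td_inner K r \<gamma> \<phi> R \<alpha> \<theta>t gm M s1 \<theta>t) (\<lambda>(ths, s2).
         map_pmf (\<lambda>t. (s2, ths ! t)) (pmf_of_set {..<M}))))"

definition td_run :: "('s \<Rightarrow> 's pmf) \<Rightarrow> ('s \<Rightarrow> 's \<Rightarrow> real) \<Rightarrow> real \<Rightarrow> ('s \<Rightarrow> real^'d)
     \<Rightarrow> real \<Rightarrow> real \<Rightarrow> nat \<Rightarrow> nat \<Rightarrow> 's pmf \<Rightarrow> real^'d \<Rightarrow> nat \<Rightarrow> ('s \<times> (real^'d)) pmf" where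
  "td_run K r \<gamma> \<phi> R \<alpha> M n \<nu> \<theta>0 m =
     ((\<lambda>p. bind_pmf p (td_epoch K r \<gamma> \<phi> R \<alpha> M n)) ^^ m) (map_pmf (\<lambda>s. (s, \<theta>0)) \<nu>)"

definition r_max :: "('s::finite \<Rightarrow> 's \<Rightarrow> real) \<Rightarrow> real" where
  "r_max r = Max {\<bar>r s s'\<bar> | s s'. True}"

definition tau_mix :: "real \<Rightarrow> real \<Rightarrow> real \<Rightarrow> nat" where
  "tau_mix \<kappa>0 \<rho> \<alpha> = (LEAST t. \<kappa>0 * \<rho> ^ t \<le> \<alpha>)"

end

theory Submission
  imports Defs
begin

text \<open>
  Every epoch contracts: from any chain state and any snapshot \<open>\<theta>t\<close> in the ball, the expected value of
  \<open>f\<close> after the epoch is at most \<open>3/4 * f \<theta>t\<close> plus a quarter of the claimed additive error, which sums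
  to the claim. Because this holds for every starting state, the dependence between the snapshot and the
  state in which an epoch ends does no harm.

  Within an epoch, the expansion of the squared distance to \<open>\<theta>*\<close> telescopes, which leaves two terms.
  The product of the iterate with the error \<open>e\<close> of the estimated mean direction is split by Young's inequality,
  and the second moment of \<open>e\<close> is controlled by the decay of correlations along the chain. The
  Markovian noise is bilinear in \<open>\<theta> - \<theta>*\<close> and \<open>\<theta> - \<theta>t\<close>. Its sampled part is evaluated at the iterate
  \<open>\<tau>\<close> steps earlier, at the price of the drift of \<open>\<theta>\<close> over \<open>\<tau>\<close> steps, after which the chain has
  mixed. Its mean part is a deterministic function of the iterate, so the delay only shifts the index of
  summation and costs boundary terms instead of drift.
\<close>

subsection \<open>Expectations and total variation\<close>

text \<open>All expectations below are taken over finite supports, so every function is integrable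
  and expectations can be iterated without side conditions.\<close>

lemma expectation_bind_pmf_finite:
  fixes h :: "'b \<Rightarrow> 'c::{banach, second_countable_topology}"
  assumes "finite (set_pmf p)" "\<And>x. x \<in> set_pmf p \<Longrightarrow> finite (set_pmf (f x))"
  shows "measure_pmf.expectation (bind_pmf p f) h
         = measure_pmf.expectation p (\<lambda>x. measure_pmf.expectation (f x) h)"
  using assms
  by (subst pmf_expectation_bind[where A = "set_pmf p"])
     (auto simp: integral_measure_pmf[where A = "set_pmf p"])

lemma expectation_mono_finite:
  fixes f g :: "'a \<Rightarrow> real"
  assumes "finite (set_pmf p)" "\<And>x. x \<in> set_pmf p \<Longrightarrow> f x \<le> g x"
  shows "measure_pmf.expectation p f \<le> measure_pmf.expectation p g"
  using assms by (intro integral_mono_AE integrable_measure_pmf_finite) (auto simp: AE_measure_pmf_iff)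

lemma expectation_sum_finite:
  fixes f :: "'i \<Rightarrow> 'a \<Rightarrow> 'c::{banach, second_countable_topology}"
  assumes "finite (set_pmf p)"
  shows "measure_pmf.expectation p (\<lambda>x. \<Sum>i\<in>I. f i x) = (\<Sum>i\<in>I. measure_pmf.expectation p (f i))"
  using assms by (intro Bochner_Integration.integral_sum integrable_measure_pmf_finite)

lemma norm_expectation_le_finite:
  fixes f :: "'a \<Rightarrow> 'c::{banach, second_countable_topology}"
  assumes "finite (set_pmf p)" "\<And>x. x \<in> set_pmf p \<Longrightarrow> norm (f x) \<le> c"
  shows "norm (measure_pmf.expectation p f) \<le> c"
proof -
  have "norm (measure_pmf.expectation p f) \<le> measure_pmf.expectation p (\<lambda>x. norm (f x))"
    by simp
  also have "\<dots> \<le> measure_pmf.expectation p (\<lambda>_. c)"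
    using assms by (intro expectation_mono_finite) auto
  finally show ?thesis by simp
qed

lemma abs_prob_diff_le_tv_dist:
  "\<bar>measure_pmf.prob p A - measure_pmf.prob q A\<bar> \<le> tv_dist p q"
  unfolding tv_dist_def
proof (rule cSUP_upper)
  show "bdd_above (range (\<lambda>A. \<bar>measure_pmf.prob p A - measure_pmf.prob q A\<bar>))"
  proof (rule bdd_aboveI2)
    fix A
    show "\<bar>measure_pmf.prob p A - measure_pmf.prob q A\<bar> \<le> 1"
      using measure_pmf.prob_le_1[of p A] measure_pmf.prob_le_1[of q A]
        measure_nonneg[of p A] measure_nonneg[of q A] by linarith
  qed
qed simp

lemma tv_dist_le_1: "tv_dist p q \<le> 1"
  unfolding tv_dist_def
proof (rule cSUP_least)
  fix A
  show "\<bar>measure_pmf.prob p A - measure_pmf.prob q A\<bar> \<le> 1"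
    using measure_pmf.prob_le_1[of p A] measure_pmf.prob_le_1[of q A]
      measure_nonneg[of p A] measure_nonneg[of q A] by linarith
qed simp

lemma expectation_finite_type:
  fixes h :: "'s::finite \<Rightarrow> 'v::{banach, second_countable_topology}"
  shows "measure_pmf.expectation p h = (\<Sum>s\<in>UNIV. pmf p s *\<^sub>R h s)"
  by (rule integral_measure_pmf) auto

text \<open>The event where \<open>p\<close> exceeds \<open>q\<close> and its complement each
  contribute one difference of probabilities, hence the factor 2.\<close>

lemma sum_abs_pmf_diff_le_tv_dist:
  fixes p q :: "'s::finite pmf"
  shows "(\<Sum>s\<in>UNIV. \<bar>pmf p s - pmf q s\<bar>) \<le> 2 * tv_dist p q"
proof -
  define A where "A = {s. pmf q s < pmf p s}"
  have prob: "measure_pmf.prob p' B = sum (pmf p') B" for p' :: "'s pmf" and B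
    by (simp add: measure_measure_pmf_finite)
  have "(\<Sum>s\<in>UNIV. \<bar>pmf p s - pmf q s\<bar>)
        = (\<Sum>s\<in>A. \<bar>pmf p s - pmf q s\<bar>) + (\<Sum>s\<in>-A. \<bar>pmf p s - pmf q s\<bar>)"
    using sum.union_disjoint[of A "-A" "\<lambda>s. \<bar>pmf p s - pmf q s\<bar>"] by (simp add: Compl_partition)
  also have "\<dots> = (\<Sum>s\<in>A. pmf p s - pmf q s) + (\<Sum>s\<in>-A. pmf q s - pmf p s)"
    by (intro arg_cong2[where f = "(+)"] sum.cong) (auto simp: A_def)
  also have "\<dots> = (measure_pmf.prob p A - measure_pmf.prob q A)
                  - (measure_pmf.prob p (-A) - measure_pmf.prob q (-A))"
    by (simp add: prob sum_subtractf)
  also have "\<dots> \<le> 2 * tv_dist p q"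
    using abs_prob_diff_le_tv_dist[of p A q] abs_prob_diff_le_tv_dist[of p "-A" q] by linarith
  finally show ?thesis .
qed

lemma norm_expectation_diff_le_tv_dist:
  fixes p q :: "'s::finite pmf" and h :: "'s \<Rightarrow> 'v::{banach, second_countable_topology}"
  assumes "\<And>s. norm (h s) \<le> B"
  shows "norm (measure_pmf.expectation p h - measure_pmf.expectation q h) \<le> 2 * B * tv_dist p q"
proof -
  have B: "0 \<le> B" using assms norm_ge_zero order_trans by blast
  have "norm (measure_pmf.expectation p h - measure_pmf.expectation q h)
        = norm (\<Sum>s\<in>UNIV. (pmf p s - pmf q s) *\<^sub>R h s)"
    by (simp add: expectation_finite_type sum_subtractf scaleR_diff_left)
  also have "\<dots> \<le> (\<Sum>s\<in>UNIV. \<bar>pmf p s - pmf q s\<bar> * B)"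
    using assms by (intro sum_norm_le) (simp add: mult_left_mono)
  also have "\<dots> = B * (\<Sum>s\<in>UNIV. \<bar>pmf p s - pmf q s\<bar>)"
    by (simp add: sum_distrib_left mult.commute)
  also have "\<dots> \<le> B * (2 * tv_dist p q)"
    by (intro mult_left_mono sum_abs_pmf_diff_le_tv_dist B)
  finally show ?thesis by (simp add: mult_ac)
qed

subsection \<open>Trajectories\<close>

text \<open>The start state is left out of the list: transition \<open>i\<close> leads from
  \<open>(s # p) ! i\<close> to \<open>p ! i\<close>, and \<open>last (s # p)\<close> is the final
  state even of an empty path.\<close>

primrec path_pmf :: "('s \<Rightarrow> 's pmf) \<Rightarrow> nat \<Rightarrow> 's \<Rightarrow> 's list pmf" where
  "path_pmf K 0 s = return_pmf []"
| "path_pmf K (Suc k) s = bind_pmf (K s) (\<lambda>s'. map_pmf ((#) s') (path_pmf K k s'))"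

lemma length_path_pmf: "p \<in> set_pmf (path_pmf K k s) \<Longrightarrow> length p = k"
  by (induction k arbitrary: s p) auto

lemma finite_path_pmf [simp]:
  fixes K :: "'s::finite \<Rightarrow> 's pmf"
  shows "finite (set_pmf (path_pmf K k s))"
proof (rule finite_subset)
  show "set_pmf (path_pmf K k s) \<subseteq> {p. set p \<subseteq> UNIV \<and> length p = k}"
    using length_path_pmf by auto
qed (rule finite_lists_length_eq, simp)

text \<open>\<open>chain_dist\<close> appends its steps at the end while \<open>path_pmf\<close>
  grows at the front; this reconciles the two recursions.\<close>

lemma chain_dist_Suc_front: "chain_dist K (Suc t) s = bind_pmf (K s) (chain_dist K t)"
proof (induction t)
  case 0
  show ?case by (simp add: bind_return_pmf bind_return_pmf')
next
  case (Suc t)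
  have "chain_dist K (Suc (Suc t)) s = bind_pmf (bind_pmf (K s) (chain_dist K t)) K"
    using Suc by simp
  also have "\<dots> = bind_pmf (K s) (\<lambda>s'. chain_dist K (Suc t) s')"
    by (simp add: bind_assoc_pmf)
  finally show ?case .
qed

lemma expectation_path_pmf_Suc:
  fixes K :: "'s::finite \<Rightarrow> 's pmf" and h :: "'s list \<Rightarrow> 'c::{banach, second_countable_topology}"
  shows "measure_pmf.expectation (path_pmf K (Suc k) s) h
    = measure_pmf.expectation (K s) (\<lambda>s'. measure_pmf.expectation (path_pmf K k s') (\<lambda>p. h (s' # p)))"
  by (simp add: expectation_bind_pmf_finite)

lemma expectation_path_transition:
  fixes K :: "'s::finite \<Rightarrow> 's pmf" and h :: "'s \<Rightarrow> 's \<Rightarrow> 'c::{banach, second_countable_topology}"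
  assumes "i < k"
  shows "measure_pmf.expectation (path_pmf K k s) (\<lambda>p. h ((s # p) ! i) (p ! i))
    = measure_pmf.expectation (chain_dist K i s) (\<lambda>u. measure_pmf.expectation (K u) (h u))"
  using assms
proof (induction i arbitrary: k s)
  case 0
  then obtain k' where "k = Suc k'" by (cases k) auto
  then show ?case by (simp only: expectation_path_pmf_Suc) simp
next
  case (Suc i)
  then obtain k' where k': "k = Suc k'" "i < k'" by (cases k) auto
  then show ?case
    unfolding chain_dist_Suc_front k'(1) expectation_path_pmf_Suc
    using Suc.IH[of k'] by (simp add: expectation_bind_pmf_finite)
qed

text \<open>The Markov property at time \<open>j\<close>: the future depends on the prefix
  \<open>q\<close> only through \<open>last (s # q)\<close>. The dependence of \<open>h\<close> on
  the prefix later carries an iterate or an earlier noise term.\<close>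

lemma expectation_path_prefix_transition:
  fixes K :: "'s::finite \<Rightarrow> 's pmf"
    and h :: "'s list \<Rightarrow> 's \<Rightarrow> 's \<Rightarrow> 'c::{banach, second_countable_topology}"
  assumes "j \<le> i" "i < k"
  shows "measure_pmf.expectation (path_pmf K k s) (\<lambda>p. h (take j p) ((s # p) ! i) (p ! i))
    = measure_pmf.expectation (path_pmf K j s) (\<lambda>q. measure_pmf.expectation
        (chain_dist K (i - j) (last (s # q))) (\<lambda>u. measure_pmf.expectation (K u) (h q u)))"
  using assms
proof (induction j arbitrary: i k s h)
  case 0
  then show ?case by (simp add: expectation_path_transition)
next
  case (Suc j)
  then obtain i' k' where eq: "i = Suc i'" "k = Suc k'" "j \<le> i'" "i' < k'"
    by (metis Suc_le_D Suc_le_mono less_Suc_eq_le less_imp_Suc_add not_less_eq Suc_less_eq)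
  show ?case
    unfolding eq(2) expectation_path_pmf_Suc
  proof (rule arg_cong[where f = "measure_pmf.expectation (K s)"], rule ext)
    fix s'
    show "measure_pmf.expectation (path_pmf K k' s')
        (\<lambda>p. h (take (Suc j) (s' # p)) ((s # s' # p) ! i) ((s' # p) ! i))
      = measure_pmf.expectation (path_pmf K j s') (\<lambda>p. measure_pmf.expectation
        (chain_dist K (i - Suc j) (last (s # s' # p)))
        (\<lambda>u. measure_pmf.expectation (K u) (h (s' # p) u)))"
      using Suc.IH[OF eq(3,4), where h = "\<lambda>q. h (s' # q)" and s = s'] eq(1) by simp
  qed
qed

subsection \<open>The smallest eigenvalue of a symmetric matrix\<close>

lemma inner_matrix_vector_symmetric:
  fixes S :: "real^'d^'d"
  assumes "transpose S = S"
  shows "u \<bullet> (S *v v) = (S *v u) \<bullet> v"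
  using assms by (metis dot_lmul_matrix inner_commute transpose_matrix_vector)

text \<open>Needed to make \<open>Min\<close> meaningful. Eigenvectors of distinct eigenvalues are
  orthogonal, hence independent, hence finite in number.\<close>

lemma finite_eigenvalues_symmetric:
  fixes S :: "real^'d^'d"
  assumes sym: "transpose S = S"
  shows "finite {l. is_eigenvalue S l}"
proof -
  define ev where "ev l = (SOME v. v \<noteq> 0 \<and> S *v v = l *s v)" for l
  have ev: "ev l \<noteq> 0" "S *v ev l = l *\<^sub>R ev l" if "is_eigenvalue S l" for l
    using someI_ex[of "\<lambda>v. v \<noteq> 0 \<and> S *v v = l *s v"] that
    unfolding is_eigenvalue_def ev_def by (auto simp: scalar_mult_eq_scaleR)
  have orth: "ev l \<bullet> ev m = 0" if "is_eigenvalue S l" "is_eigenvalue S m" "l \<noteq> m" for l m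
  proof -
    have "l * (ev l \<bullet> ev m) = m * (ev l \<bullet> ev m)"
      using inner_matrix_vector_symmetric[OF sym, of "ev l" "ev m"] ev that by simp
    then show ?thesis using that(3) by simp
  qed
  have inj: "inj_on ev {l. is_eigenvalue S l}"
    using orth ev(1) by (intro inj_onI) (metis inner_eq_zero_iff mem_Collect_eq)
  have "independent (ev ` {l. is_eigenvalue S l})"
  proof (rule pairwise_orthogonal_independent)
    show "pairwise orthogonal (ev ` {l. is_eigenvalue S l})"
      using orth by (auto simp: pairwise_def orthogonal_def)
    show "0 \<notin> ev ` {l. is_eigenvalue S l}" using ev(1) by auto
  qed
  then have "finite (ev ` {l. is_eigenvalue S l})"
    by (rule finiteI_independent)
  then show ?thesis using inj by (rule finite_imageD)
qed

text \<open>The minimum of the quadratic form over the unit sphere is attained at an eigenvector.\<close>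
lemma min_eigenvalue_le_quadratic_form:
  fixes S :: "real^'d^'d"
  assumes sym: "transpose S = S"
  shows "min_eigenvalue S * (norm x)\<^sup>2 \<le> x \<bullet> (S *v x)"
proof -
  have "\<exists>v\<in>sphere 0 1. \<forall>w\<in>sphere 0 1. v \<bullet> (S *v v) \<le> w \<bullet> (S *v w)"
  proof (rule continuous_attains_inf)
    show "compact (sphere (0::real^'d) 1)" by simp
    show "sphere (0::real^'d) 1 \<noteq> {}" by simp
    show "continuous_on (sphere 0 1) (\<lambda>v::real^'d. v \<bullet> (S *v v))"
      by (intro continuous_intros linear_continuous_on_compose[where g = "\<lambda>v. S *v v"])
         (auto intro: continuous_intros)
  qed
  then obtain v where v: "norm v = 1" and min: "\<And>w. norm w = 1 \<Longrightarrow> v \<bullet> (S *v v) \<le> w \<bullet> (S *v w)"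
    by auto
  define l where "l = v \<bullet> (S *v v)"
  have low: "l * (norm w)\<^sup>2 \<le> w \<bullet> (S *v w)" for w
  proof (cases "w = 0")
    case False
    have "l \<le> (w /\<^sub>R norm w) \<bullet> (S *v (w /\<^sub>R norm w))"
      unfolding l_def using False by (intro min) simp
    also have "\<dots> = w \<bullet> (S *v w) / (norm w)\<^sup>2"
      by (simp add: matrix_vector_mult_scaleR power2_eq_square divide_inverse)
    finally show ?thesis using False by (simp add: field_simps)
  qed simp
  \<comment> \<open>The residual of the eigenvalue equation. If it were nonzero, moving from the
    minimiser \<open>v\<close> along \<open>- z\<close> would violate \<open>low\<close>.\<close>
  define z where "z = S *v v - l *\<^sub>R v"
  have "z \<bullet> z = 0"
  proof (rule ccontr)
    assume nz: "z \<bullet> z \<noteq> 0"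
    define c where "c = z \<bullet> (S *v z) - l * (norm z)\<^sup>2"
    have c: "0 \<le> c" using low[of z] by (simp add: c_def)
    have q: "0 \<le> 2 * t * (z \<bullet> z) + t\<^sup>2 * c" for t
    proof -
      have "0 \<le> (v + t *\<^sub>R z) \<bullet> (S *v (v + t *\<^sub>R z)) - l * (norm (v + t *\<^sub>R z))\<^sup>2"
        using low[of "v + t *\<^sub>R z"] by simp
      also have "\<dots> = (v \<bullet> (S *v v) - l * (v \<bullet> v)) + 2 * t * (z \<bullet> (S *v v) - l * (z \<bullet> v)) + t\<^sup>2 * c"
        using inner_matrix_vector_symmetric[OF sym, of v z]
        unfolding c_def power2_norm_eq_inner
        by (simp add: matrix_vector_mult_scaleR algebra_simps power2_eq_square inner_commute)
      also have "v \<bullet> (S *v v) - l * (v \<bullet> v) = 0" using v by (simp add: l_def norm_eq_1)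
      also have "z \<bullet> (S *v v) - l * (z \<bullet> v) = z \<bullet> z"
        by (simp add: z_def inner_diff_right inner_diff_left algebra_simps)
      finally show ?thesis by simp
    qed
    have zp: "0 < z \<bullet> z" using nz inner_ge_zero[of z] by linarith
    \<comment> \<open>A small enough negative step for the linear term to win; \<open>c + 1\<close>
      replaces \<open>c\<close> because \<open>c\<close> may vanish.\<close>
    define t where "t = - (z \<bullet> z) / (c + 1)"
    have t: "t * (c + 1) = - (z \<bullet> z)" "t < 0" using c zp by (auto simp: t_def field_simps)
    have "2 * t * (z \<bullet> z) + t\<^sup>2 * c \<le> 2 * t * (z \<bullet> z) + t * (t * (c + 1))"
      by (simp add: power2_eq_square algebra_simps)
    also have "\<dots> = t * (z \<bullet> z)" unfolding t(1) by simp
    also have "\<dots> < 0" using zp t(2) by (simp add: mult_neg_pos)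
    finally show False using q[of t] by linarith
  qed
  then have "is_eigenvalue S l"
    unfolding is_eigenvalue_def using v by (intro exI[of _ v]) (auto simp: z_def scalar_mult_eq_scaleR)
  then have "min_eigenvalue S \<le> l"
    unfolding min_eigenvalue_def using finite_eigenvalues_symmetric[OF sym] by (intro Min_le) auto
  then show ?thesis
    using low[of x] by (meson mult_right_mono order_trans zero_le_power2)
qed

subsection \<open>Variance of trajectory averages\<close>

text \<open>The induction step has slack because \<open>\<kappa> N \<le> N\<close> and
  \<open>t \<le> 1\<close>. The negative quadratic term is kept since it later cancels half of the
  square coming from the convolution.\<close>

lemma sum_partial_sums_le:
  fixes t :: "nat \<Rightarrow> real"
  assumes t: "\<And>i. 0 \<le> t i" "\<And>i. t i \<le> 1"
  defines "\<kappa> \<equiv> \<lambda>n. \<Sum>i<n. t (Suc i)"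
  shows "(\<Sum>m<N. \<kappa> m) \<le> real N * \<kappa> N - (\<kappa> N)\<^sup>2 / 2 - \<kappa> N / 2"
proof (induction N)
  case 0
  show ?case by (simp add: \<kappa>_def)
next
  case (Suc N)
  have S: "\<kappa> (Suc N) = \<kappa> N + t (Suc N)" by (simp add: \<kappa>_def)
  have "\<kappa> N \<le> real N"
    unfolding \<kappa>_def using sum_bounded_above[of "{..<N}" "\<lambda>i. t (Suc i)" 1] t by simp
  then have "0 \<le> t (Suc N) * (real N + 1 - \<kappa> N - t (Suc N) / 2 - 1 / 2)"
    using t[of "Suc N"] by (intro mult_nonneg_nonneg) auto
  then show ?case
    using Suc unfolding S by (simp add: algebra_simps power2_eq_square add_divide_distrib)
qed

text \<open>Summing over \<open>m\<close> first produces partial sums of \<open>t\<close>, each at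
  most \<open>\<kappa> N\<close>; the remaining factors \<open>t k\<close> add up to at most
  \<open>t 0 + \<kappa> N\<close>.\<close>

lemma sum_convolution_le:
  fixes t :: "nat \<Rightarrow> real"
  assumes t: "\<And>i. 0 \<le> t i" "\<And>i. t i \<le> 1"
  defines "\<kappa> \<equiv> \<lambda>n. \<Sum>i<n. t (Suc i)"
  shows "(\<Sum>m<N. \<Sum>k<m. t k * t (m - k)) \<le> (1 + \<kappa> N) * \<kappa> N"
proof -
  have "(\<Sum>m<N. \<Sum>k<m. t k * t (m - k)) = (\<Sum>k<N. t k * \<kappa> (N - 1 - k))"
  proof (induction N)
    case (Suc N)
    have "(\<Sum>k<Suc N. t k * \<kappa> (Suc N - 1 - k)) = (\<Sum>k<N. t k * \<kappa> (N - k))"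
      by (simp add: \<kappa>_def)
    also have "\<dots> = (\<Sum>k<N. t k * \<kappa> (N - 1 - k) + t k * t (N - k))"
    proof (rule sum.cong[OF refl])
      fix k assume "k \<in> {..<N}"
      then have "N - k = Suc (N - 1 - k)" by auto
      then show "t k * \<kappa> (N - k) = t k * \<kappa> (N - 1 - k) + t k * t (N - k)"
        by (simp add: \<kappa>_def distrib_left)
    qed
    finally show ?case using Suc by (simp add: sum.distrib)
  qed simp
  also have "\<dots> \<le> (\<Sum>k<N. t k * \<kappa> N)"
    unfolding \<kappa>_def using t by (intro sum_mono mult_left_mono sum_mono2) auto
  also have "\<dots> = (\<Sum>k<N. t k) * \<kappa> N" by (simp add: sum_distrib_right)
  also have "\<dots> \<le> (1 + \<kappa> N) * \<kappa> N"
  proof (rule mult_right_mono)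
    have "(\<Sum>k<N. t k) \<le> (\<Sum>k<Suc N. t k)" using t by (intro sum_mono2) auto
    also have "\<dots> = t 0 + \<kappa> N" unfolding \<kappa>_def by (rule sum.lessThan_Suc_shift)
    finally show "(\<Sum>k<N. t k) \<le> 1 + \<kappa> N" using t(2)[of 0] by linarith
    show "0 \<le> \<kappa> N" unfolding \<kappa>_def using t by (intro sum_nonneg) auto
  qed
  finally show ?thesis .
qed

text \<open>The summand at \<open>(k, m)\<close> bounds the correlation of the noise at times \<open>k < m\<close>:
  adjacent times are decoupled by the inequality of means, more distant ones by mixing.\<close>
lemma sum_correlation_bounds_le:
  fixes t :: "nat \<Rightarrow> real"
  assumes t: "\<And>i. 0 \<le> t i" "\<And>i. t i \<le> 1" and K: "\<And>n. (\<Sum>i<n. t (Suc i)) \<le> K"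
    and n: "1 \<le> n"
  defines "a \<equiv> \<lambda>k. (1 + t k)\<^sup>2"
  shows "(\<Sum>m<n. a m + 2 * (\<Sum>k<m. if Suc k = m then (a k + a m) / 2
            else 2 * (1 + t k) * t (m - Suc k)))
         \<le> 4 * real n * (1 + K) - real n + 2 * (1 + K)\<^sup>2 + 3 * (1 + K)"
proof -
  define \<kappa> where "\<kappa> = (\<lambda>n. \<Sum>i<n. t (Suc i))"
  obtain N where N: "n = Suc N" using n by (cases n) auto
  have a: "a m \<le> 1 + 3 * t m" for m
    using mult_left_mono[OF t(2)[of m] t(1)[of m]] by (simp add: a_def power2_eq_square algebra_simps)
  have inner: "(\<Sum>k<Suc m. if Suc k = Suc m then (a k + a (Suc m)) / 2
            else 2 * (1 + t k) * t (Suc m - Suc k))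
      = (a m + a (Suc m)) / 2 + 2 * \<kappa> m + 2 * (\<Sum>k<m. t k * t (m - k))" for m
  proof -
    have "(\<Sum>k<Suc m. if Suc k = Suc m then (a k + a (Suc m)) / 2
            else 2 * (1 + t k) * t (Suc m - Suc k))
        = (\<Sum>k<m. 2 * t (m - k) + 2 * (t k * t (m - k))) + (a m + a (Suc m)) / 2"
      by (simp add: algebra_simps)
    also have "(\<Sum>k<m. 2 * t (m - k) + 2 * (t k * t (m - k)))
        = 2 * (\<Sum>k<m. t (m - k)) + 2 * (\<Sum>k<m. t k * t (m - k))"
      by (simp add: sum.distrib sum_distrib_left)
    also have "(\<Sum>k<m. t (m - k)) = \<kappa> m"
      unfolding \<kappa>_def using sum.nat_diff_reindex[of "\<lambda>i. t (Suc i)" m]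
      by (simp add: Suc_diff_Suc)
    finally show ?thesis by simp
  qed
  \<comment> \<open>The term \<open>- 3 * t N\<close> makes the induction step exact once
    \<open>a m\<close> is replaced by \<open>1 + 3 * t m\<close>: each \<open>t\<close> enters twice
    through \<open>a (Suc m)\<close> and once more, a step later, through
    \<open>a m\<close>.\<close>
  have diag: "a 0 + (\<Sum>m<N. 2 * a (Suc m) + a m) \<le> 3 * real N + 8 + 9 * \<kappa> N - 3 * t N" for N
  proof (induction N)
    case 0
    show ?case using a[of 0] t[of 0] by (simp add: \<kappa>_def)
  next
    case (Suc N)
    then show ?case using a[of N] a[of "Suc N"] by (simp add: \<kappa>_def)
  qed
  have "(\<Sum>m<n. a m + 2 * (\<Sum>k<m. if Suc k = m then (a k + a m) / 2
            else 2 * (1 + t k) * t (m - Suc k)))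
      = a 0 + (\<Sum>m<N. a (Suc m) + 2 * ((a m + a (Suc m)) / 2 + 2 * \<kappa> m
          + 2 * (\<Sum>k<m. t k * t (m - k))))"
    unfolding N sum.lessThan_Suc_shift[of _ N] inner by simp
  also have "\<dots> = (a 0 + (\<Sum>m<N. 2 * a (Suc m) + a m)) + 4 * (\<Sum>m<N. \<kappa> m)
                  + 4 * (\<Sum>m<N. \<Sum>k<m. t k * t (m - k))"
    by (simp add: sum.distrib sum_distrib_left sum_distrib_right algebra_simps add_divide_distrib)
  also have "\<dots> \<le> (3 * real N + 8 + 9 * \<kappa> N)
      + 4 * (real N * \<kappa> N - (\<kappa> N)\<^sup>2 / 2 - \<kappa> N / 2) + 4 * ((1 + \<kappa> N) * \<kappa> N)"
  proof (rule add_mono[OF add_mono])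
    show "a 0 + (\<Sum>m<N. 2 * a (Suc m) + a m) \<le> 3 * real N + 8 + 9 * \<kappa> N"
      using diag[of N] t(1)[of N] by simp
  qed (use sum_partial_sums_le[where t = t and N = N, OF t]
        sum_convolution_le[where t = t and N = N, OF t] in \<open>auto simp: \<kappa>_def\<close>)
  also have "\<dots> = 3 * real n + 5 + 4 * real n * \<kappa> N + 7 * \<kappa> N + 2 * (\<kappa> N)\<^sup>2"
    by (simp add: N algebra_simps power2_eq_square)
  also have "\<dots> \<le> 3 * real n + 5 + 4 * real n * K + 7 * K + 2 * K\<^sup>2"
    using K[of N] t(1) by (intro add_mono mult_left_mono power_mono) (auto simp: \<kappa>_def sum_nonneg)
  finally show ?thesis by (simp add: algebra_simps power2_eq_square)
qed

lemma norm_sum_squared: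
  fixes f :: "nat \<Rightarrow> 'a::real_inner"
  shows "(norm (\<Sum>k<n. f k))\<^sup>2 = (\<Sum>m<n. (norm (f m))\<^sup>2 + 2 * (\<Sum>k<m. f k \<bullet> f m))"
  by (induction n) (simp_all add: power2_norm_eq_inner inner_add inner_sum_right inner_commute)

lemma expectation_inner_left_finite:
  fixes f :: "'a \<Rightarrow> 'v::euclidean_space"
  assumes "finite (set_pmf p)"
  shows "measure_pmf.expectation p (\<lambda>x. f x \<bullet> c) = measure_pmf.expectation p f \<bullet> c"
  by (rule integral_inner_left) (intro integrable_measure_pmf_finite assms)

lemma expectation_inner_right_finite:
  fixes f :: "'a \<Rightarrow> 'v::euclidean_space"
  assumes "finite (set_pmf p)"
  shows "measure_pmf.expectation p (\<lambda>x. c \<bullet> f x) = c \<bullet> measure_pmf.expectation p f"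
  by (rule integral_inner_right) (intro integrable_measure_pmf_finite assms)

lemmas expectation_linear =
  Bochner_Integration.integral_add[OF integrable_measure_pmf_finite integrable_measure_pmf_finite]
  Bochner_Integration.integral_diff[OF integrable_measure_pmf_finite integrable_measure_pmf_finite]

section \<open>Noise and correlations along an ergodic chain\<close>

locale ergodic_chain =
  fixes K :: "'s::finite \<Rightarrow> 's pmf" and \<mu> :: "'s pmf" and \<kappa>0 \<rho> :: real
  assumes stat: "stationary_dist K \<mu>" and kappa: "0 < \<kappa>0" and rho: "0 < \<rho>" "\<rho> < 1"
    and ergodic: "\<And>t s. tv_dist (chain_dist K t s) \<mu> \<le> \<kappa>0 * \<rho> ^ t"
begin

text \<open>The cap at 1 is legitimate because total variation never exceeds 1, and it supplies the
  condition \<open>t i \<le> 1\<close> of the summation lemmas.\<close>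

definition mix :: "nat \<Rightarrow> real" where
  "mix j = min 1 (\<kappa>0 * \<rho> ^ j)"

text \<open>The geometric series of \<open>\<kappa>0 * \<rho> ^ j\<close> over
  \<open>j \<ge> 1\<close>. With lag 0 counted as 1, \<open>1 + K_mix\<close> is the mixing factor
  in \<open>C_2\<close>.\<close>

definition K_mix :: real where
  "K_mix = \<kappa>0 * \<rho> / (1 - \<rho>)"

definition stat_mean :: "('s \<Rightarrow> 's \<Rightarrow> 'v) \<Rightarrow> 'v::euclidean_space" where
  "stat_mean W = measure_pmf.expectation \<mu> (\<lambda>s. measure_pmf.expectation (K s) (W s))"

lemma mix_nonneg: "0 \<le> mix j" and mix_le_1: "mix j \<le> 1"
  using kappa rho by (auto simp: mix_def)

lemma K_mix_nonneg: "0 \<le> K_mix"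
  using kappa rho by (simp add: K_mix_def)

lemma sum_mix_le: "(\<Sum>i<n. mix (Suc i)) \<le> K_mix"
proof -
  have "(\<Sum>i<n. mix (Suc i)) \<le> (\<Sum>i<n. \<kappa>0 * \<rho> * \<rho> ^ i)"
    by (intro sum_mono) (simp add: mix_def mult.assoc)
  also have "\<dots> = \<kappa>0 * \<rho> * ((1 - \<rho> ^ n) / (1 - \<rho>))"
    using rho by (simp add: sum_distrib_left[symmetric] sum_gp_strict)
  also have "\<dots> \<le> \<kappa>0 * \<rho> * (1 / (1 - \<rho>))"
    using kappa rho by (intro mult_left_mono divide_right_mono) auto
  finally show ?thesis by (simp add: K_mix_def)
qed

lemma norm_stat_mean_le:
  assumes "\<And>s s'. norm (W s s') \<le> B"
  shows "norm (stat_mean W) \<le> B"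
  unfolding stat_mean_def using assms by (intro norm_expectation_le_finite) auto

lemma norm_mixing_le:
  fixes W :: "'s \<Rightarrow> 's \<Rightarrow> 'v::euclidean_space"
  assumes W: "\<And>s s'. norm (W s s') \<le> B"
  shows "norm (measure_pmf.expectation (chain_dist K j s)
      (\<lambda>u. measure_pmf.expectation (K u) (W u)) - stat_mean W) \<le> 2 * B * mix j"
proof -
  have B: "0 \<le> B" using W norm_ge_zero order_trans by blast
  have "norm (measure_pmf.expectation (chain_dist K j s)
      (\<lambda>u. measure_pmf.expectation (K u) (W u)) - stat_mean W) \<le> 2 * B * tv_dist (chain_dist K j s) \<mu>"
    unfolding stat_mean_def using W
    by (intro norm_expectation_diff_le_tv_dist norm_expectation_le_finite) auto
  also have "\<dots> \<le> 2 * B * mix j"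
    using ergodic[of j s] tv_dist_le_1 B by (intro mult_left_mono) (auto simp: mix_def)
  finally show ?thesis .
qed

text \<open>Expanding the square leaves the inner product of the mean at time \<open>j\<close> with
  the stationary mean, and mixing makes the two means close. The start state is arbitrary;
  \<open>mix j\<close> pays for the distance from stationarity.\<close>

lemma noise_second_moment_le:
  fixes W :: "'s \<Rightarrow> 's \<Rightarrow> 'v::euclidean_space"
  assumes W: "\<And>s s'. norm (W s s') \<le> B"
  shows "measure_pmf.expectation (chain_dist K j s) (\<lambda>u. measure_pmf.expectation (K u)
           (\<lambda>u'. (norm (W u u' - stat_mean W))\<^sup>2)) \<le> B\<^sup>2 * (1 + mix j)\<^sup>2"
proof -
  define w where "w = stat_mean W"
  define m where "m = measure_pmf.expectation (chain_dist K j s)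
      (\<lambda>u. measure_pmf.expectation (K u) (W u))"
  have w: "norm w \<le> B" unfolding w_def by (rule norm_stat_mean_le) (rule W)
  have B: "0 \<le> B" using w norm_ge_zero order_trans by blast
  have "(norm (W u u' - w))\<^sup>2 \<le> (B\<^sup>2 + (norm w)\<^sup>2) - 2 * (W u u' \<bullet> w)" for u u'
    using power_mono[OF W norm_ge_zero, of u u' 2]
    by (simp add: power2_norm_eq_inner inner_diff inner_commute)
  then have "measure_pmf.expectation (chain_dist K j s) (\<lambda>u. measure_pmf.expectation (K u)
      (\<lambda>u'. (norm (W u u' - w))\<^sup>2))
    \<le> measure_pmf.expectation (chain_dist K j s) (\<lambda>u. measure_pmf.expectation (K u)
      (\<lambda>u'. (B\<^sup>2 + (norm w)\<^sup>2) - 2 * (W u u' \<bullet> w)))"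
    by (intro expectation_mono_finite) auto
  also have "\<dots> = (B\<^sup>2 + (norm w)\<^sup>2) - 2 * (m \<bullet> w)"
    by (simp add: expectation_linear expectation_inner_left_finite m_def)
  also have "\<dots> = B\<^sup>2 - (norm w)\<^sup>2 - 2 * ((m - w) \<bullet> w)"
    by (simp add: inner_diff_left power2_norm_eq_inner)
  also have "\<dots> \<le> B\<^sup>2 - (norm w)\<^sup>2 + 2 * (2 * B * mix j * norm w)"
  proof -
    have "\<bar>(m - w) \<bullet> w\<bar> \<le> norm (m - w) * norm w" by (rule Cauchy_Schwarz_ineq2)
    also have "\<dots> \<le> (2 * B * mix j) * norm w"
      unfolding m_def w_def by (intro mult_right_mono norm_mixing_le W norm_ge_zero)
    finally show ?thesis by linarith
  qed
  also have "\<dots> \<le> B\<^sup>2 * (1 + mix j)\<^sup>2"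
  proof -
    \<comment> \<open>This is exactly the gap in the claim, written as a square plus a product that
      is nonnegative because \<open>norm w \<le> B\<close>.\<close>
    have "0 \<le> (B * mix j - norm w)\<^sup>2 + 2 * mix j * B * (B - norm w)"
      using w B mix_nonneg by (intro add_nonneg_nonneg mult_nonneg_nonneg) auto
    then show ?thesis by (simp add: power2_eq_square algebra_simps)
  qed
  finally show ?thesis unfolding w_def .
qed

text \<open>Jensen's inequality, obtained from \<open>2 * c * x \<le> x\<^sup>2 + c\<^sup>2\<close>
  with \<open>c\<close> the root of the second moment bound. The case \<open>c = 0\<close> is
  separate because \<open>c\<close> is cancelled.\<close>

lemma noise_first_moment_le:
  fixes W :: "'s \<Rightarrow> 's \<Rightarrow> 'v::euclidean_space"
  assumes W: "\<And>s s'. norm (W s s') \<le> B"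
  shows "measure_pmf.expectation (chain_dist K j s) (\<lambda>u. measure_pmf.expectation (K u)
           (\<lambda>u'. norm (W u u' - stat_mean W))) \<le> B * (1 + mix j)"
proof -
  define c where "c = B * (1 + mix j)"
  define m1 where "m1 = measure_pmf.expectation (chain_dist K j s) (\<lambda>u.
      measure_pmf.expectation (K u) (\<lambda>u'. norm (W u u' - stat_mean W)))"
  have B: "0 \<le> B" using W norm_ge_zero order_trans by blast
  have c: "0 \<le> c" using B mix_nonneg by (simp add: c_def)
  show ?thesis
  proof (cases "c = 0")
    case True
    then have "B = 0" using mix_nonneg[of j] by (simp add: c_def)
    moreover have "norm (stat_mean W) \<le> B" by (rule norm_stat_mean_le) (rule W)
    ultimately show ?thesis using W by simp
  next
    case False
    have "2 * c * norm (W u u' - stat_mean W) \<le> (norm (W u u' - stat_mean W))\<^sup>2 + c\<^sup>2" for u u'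
      using sum_squares_bound[of c "norm (W u u' - stat_mean W)"] by simp
    then have "measure_pmf.expectation (chain_dist K j s) (\<lambda>u. measure_pmf.expectation (K u)
        (\<lambda>u'. 2 * c * norm (W u u' - stat_mean W)))
      \<le> measure_pmf.expectation (chain_dist K j s) (\<lambda>u. measure_pmf.expectation (K u)
        (\<lambda>u'. (norm (W u u' - stat_mean W))\<^sup>2 + c\<^sup>2))"
      by (intro expectation_mono_finite) auto
    also have "\<dots> \<le> c\<^sup>2 + c\<^sup>2"
      using noise_second_moment_le[where W = W, OF W, of j s]
      by (simp add: expectation_linear c_def power_mult_distrib)
    finally have "c * m1 \<le> c * c"
      by (simp add: m1_def power2_eq_square)
    then have "m1 \<le> c" using c False by (intro mult_left_le_imp_le[of c m1 c]) auto
    then show ?thesis by (simp add: m1_def c_def)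
  qed
qed

text \<open>Conditioning on the first \<open>Suc k\<close> steps fixes the noise at time
  \<open>k\<close>. The later noise then has conditional mean \<open>\<delta>\<close>, small by
  mixing over the \<open>m - Suc k\<close> steps left after transition \<open>k\<close> has
  ended.\<close>

lemma noise_correlation_le:
  fixes W :: "'s \<Rightarrow> 's \<Rightarrow> 'v::euclidean_space"
  assumes W: "\<And>s s'. norm (W s s') \<le> B" and km: "k < m" "m < n"
  defines "\<xi> \<equiv> \<lambda>u u'. W u u' - stat_mean W"
  shows "measure_pmf.expectation (path_pmf K n s)
      (\<lambda>p. \<xi> ((s # p) ! k) (p ! k) \<bullet> \<xi> ((s # p) ! m) (p ! m))
    \<le> 2 * B\<^sup>2 * (1 + mix k) * mix (m - Suc k)"
proof -
  define \<delta> where "\<delta> = (\<lambda>u. measure_pmf.expectation (chain_dist K (m - Suc k) u)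
      (\<lambda>u. measure_pmf.expectation (K u) (\<xi> u)))"
  have B: "0 \<le> B" using W norm_ge_zero order_trans by blast
  have \<delta>: "norm (\<delta> u) \<le> 2 * B * mix (m - Suc k)" for u
    using norm_mixing_le[where W = W, OF W, of "m - Suc k" u]
    by (simp add: \<delta>_def \<xi>_def expectation_linear)
  have nth_take_Cons: "(s # take (Suc k) p) ! k = (s # p) ! k" for p :: "'s list"
    by (cases k) auto
  have "measure_pmf.expectation (path_pmf K n s)
      (\<lambda>p. \<xi> ((s # p) ! k) (p ! k) \<bullet> \<xi> ((s # p) ! m) (p ! m))
    = measure_pmf.expectation (path_pmf K (Suc k) s)
      (\<lambda>q. \<xi> ((s # q) ! k) (q ! k) \<bullet> \<delta> (last (s # q)))"
    using expectation_path_prefix_transition[of "Suc k" m n K s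
        "\<lambda>q u u'. \<xi> ((s # q) ! k) (q ! k) \<bullet> \<xi> u u'"] km
    by (simp add: nth_take_Cons \<delta>_def expectation_inner_right_finite del: take_Suc_Cons last.simps)
  also have "\<dots> \<le> measure_pmf.expectation (path_pmf K (Suc k) s)
      (\<lambda>q. 2 * B * mix (m - Suc k) * norm (\<xi> ((s # q) ! k) (q ! k)))"
  proof (rule expectation_mono_finite)
    fix q :: "'s list"
    have "\<xi> ((s # q) ! k) (q ! k) \<bullet> \<delta> (last (s # q))
        \<le> norm (\<xi> ((s # q) ! k) (q ! k)) * norm (\<delta> (last (s # q)))"
      by (rule norm_cauchy_schwarz)
    also have "\<dots> \<le> norm (\<xi> ((s # q) ! k) (q ! k)) * (2 * B * mix (m - Suc k))"
      by (intro mult_left_mono \<delta> norm_ge_zero)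
    finally show "\<xi> ((s # q) ! k) (q ! k) \<bullet> \<delta> (last (s # q))
        \<le> 2 * B * mix (m - Suc k) * norm (\<xi> ((s # q) ! k) (q ! k))" by (simp add: mult_ac)
  qed simp
  also have "\<dots> = 2 * B * mix (m - Suc k) * measure_pmf.expectation (path_pmf K (Suc k) s)
      (\<lambda>q. norm (\<xi> ((s # q) ! k) (q ! k)))"
    by simp
  also have "\<dots> \<le> 2 * B * mix (m - Suc k) * (B * (1 + mix k))"
    using noise_first_moment_le[where W = W, OF W, of k s] B mix_nonneg
      expectation_path_transition[of k "Suc k" K s "\<lambda>u u'. norm (\<xi> u u')"]
    by (intro mult_left_mono) (auto simp: \<xi>_def)
  finally show ?thesis by (simp only: power2_eq_square mult_ac)
qed

lemma trajectory_variance_le: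
  fixes W :: "'s \<Rightarrow> 's \<Rightarrow> 'v::euclidean_space"
  assumes W: "\<And>s s'. norm (W s s') \<le> B" and n: "1 \<le> n"
  defines "k \<equiv> 1 + K_mix"
  shows "measure_pmf.expectation (path_pmf K n s)
      (\<lambda>p. (norm (\<Sum>i<n. W ((s # p) ! i) (p ! i) - stat_mean W))\<^sup>2)
    \<le> B\<^sup>2 * (4 * real n * k - real n + 2 * k\<^sup>2 + 3 * k)"
proof -
  define \<xi> where "\<xi> = (\<lambda>u u'. W u u' - stat_mean W)"
  define X where "X = (\<lambda>i p. \<xi> ((s # p) ! i) (p ! i))"
  let ?E = "measure_pmf.expectation (path_pmf K n s)"
  define a where "a = (\<lambda>i. (1 + mix i)\<^sup>2)"
  have sq: "?E (\<lambda>p. (norm (X i p))\<^sup>2) \<le> B\<^sup>2 * a i" if "i < n" for i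
    using noise_second_moment_le[where W = W, OF W, of i s]
      expectation_path_transition[OF that, of K s "\<lambda>u u'. (norm (\<xi> u u'))\<^sup>2"]
    by (simp add: X_def \<xi>_def a_def)
  have cross: "?E (\<lambda>p. X i p \<bullet> X m p) \<le> B\<^sup>2 * (if Suc i = m then (a i + a m) / 2
      else 2 * (1 + mix i) * mix (m - Suc i))" if "i < m" "m < n" for i m
  proof (cases "Suc i = m")
    case True
    have "X i p \<bullet> X m p \<le> ((norm (X i p))\<^sup>2 + (norm (X m p))\<^sup>2) / 2" for p
      using inner_ge_zero[of "X i p - X m p"]
      by (simp add: power2_norm_eq_inner inner_diff inner_commute)
    then have "?E (\<lambda>p. X i p \<bullet> X m p) \<le> ?E (\<lambda>p. ((norm (X i p))\<^sup>2 + (norm (X m p))\<^sup>2) / 2)"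
      by (intro expectation_mono_finite) auto
    also have "\<dots> = (?E (\<lambda>p. (norm (X i p))\<^sup>2) + ?E (\<lambda>p. (norm (X m p))\<^sup>2)) / 2"
      by (simp add: expectation_linear)
    finally show ?thesis
      using sq[of i] sq[of m] that True by (simp add: distrib_left)
  next
    case False
    then show ?thesis
      using noise_correlation_le[where W = W, OF W that, of s] by (simp add: X_def \<xi>_def algebra_simps)
  qed
  have "?E (\<lambda>p. (norm (\<Sum>i<n. X i p))\<^sup>2)
      = (\<Sum>m<n. ?E (\<lambda>p. (norm (X m p))\<^sup>2) + 2 * (\<Sum>i<m. ?E (\<lambda>p. X i p \<bullet> X m p)))"
    by (simp add: norm_sum_squared expectation_sum_finite expectation_linear)
  also have "\<dots> \<le> (\<Sum>m<n. B\<^sup>2 * a m + 2 * (\<Sum>i<m. B\<^sup>2 * (if Suc i = m then (a i + a m) / 2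
      else 2 * (1 + mix i) * mix (m - Suc i))))"
    by (intro sum_mono add_mono mult_left_mono sq cross) auto
  also have "\<dots> = B\<^sup>2 * (\<Sum>m<n. a m + 2 * (\<Sum>i<m. if Suc i = m then (a i + a m) / 2
      else 2 * (1 + mix i) * mix (m - Suc i)))"
    by (simp add: sum_distrib_left distrib_left mult_ac)
  also have "\<dots> \<le> B\<^sup>2 * (4 * real n * k - real n + 2 * k\<^sup>2 + 3 * k)"
    unfolding a_def k_def
    by (intro mult_left_mono sum_correlation_bounds_le mix_nonneg mix_le_1 sum_mix_le n) auto
  finally show ?thesis by (simp add: X_def \<xi>_def)
qed

end

subsection \<open>Temporal difference learning\<close>

lemma outer_mult_vector: "outer u v *v y = (v \<bullet> y) *\<^sub>R (u :: real^'d)"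
  by (simp add: vec_eq_iff outer_def matrix_vector_mult_def inner_vec_def sum_distrib_left sum_distrib_right mult_ac)

lemma linear_matrix_vector_mult_left: "linear (\<lambda>A :: real^'d^'d. A *v y)"
  by (rule linearI) (simp_all add: matrix_vector_mult_add_rdistrib scaleR_matrix_vector_assoc)

text \<open>For a unit vector \<open>u\<close> this map is half of a reflection, so its norm is
  exactly half; a shorter \<open>u\<close> only decreases the square.\<close>

lemma norm_reflection_half_le:
  fixes u y :: "'v::real_inner"
  assumes "norm u \<le> 1"
  shows "norm ((u \<bullet> y) *\<^sub>R u - (1/2) *\<^sub>R y) \<le> norm y / 2"
proof (rule power2_le_imp_le)
  have "(norm ((u \<bullet> y) *\<^sub>R u - (1/2) *\<^sub>R y))\<^sup>2 = (u \<bullet> y)\<^sup>2 * ((norm u)\<^sup>2 - 1) + (norm y / 2)\<^sup>2"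
    unfolding power2_norm_eq_inner power_divide
    by (simp add: inner_diff power2_eq_square inner_commute algebra_simps)
  also have "\<dots> \<le> (norm y / 2)\<^sup>2"
    using power_mono[OF assms norm_ge_zero, of 2] by (simp add: mult_nonneg_nonpos)
  finally show "(norm ((u \<bullet> y) *\<^sub>R u - (1/2) *\<^sub>R y))\<^sup>2 \<le> (norm y / 2)\<^sup>2" .
qed simp

lemma abs_le_r_max: "\<bar>r s s'\<bar> \<le> r_max r"
  unfolding r_max_def
proof (rule Max_ge)
  have "{\<bar>r s s'\<bar> |s s'. True} = (\<lambda>(s, s'). \<bar>r s s'\<bar>) ` UNIV" by auto
  then show "finite {\<bar>r s s'\<bar> |s s'. True}" by simp
qed auto

lemma r_max_nonneg: "0 \<le> r_max r"
  using abs_le_r_max[of r undefined undefined] by linarith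

text \<open>By truncated subtraction the first \<open>\<tau>\<close> delayed terms all equal
  \<open>u 0 = 0\<close>, so a delay merely removes the last terms of the sum.\<close>

lemma sum_delayed:
  fixes u :: "nat \<Rightarrow> 'a::comm_monoid_add"
  assumes "u 0 = 0"
  shows "(\<Sum>i<M. u (i - \<tau>)) = (\<Sum>i<M - \<tau>. u i)"
proof (induction M)
  case (Suc M)
  then show ?case by (cases "\<tau> \<le> M") (auto simp: Suc_diff_le assms)
qed simp

lemma sum_minus_delayed_le:
  fixes u :: "nat \<Rightarrow> real"
  assumes "u 0 = 0" and u: "\<And>i. i < M \<Longrightarrow> u i \<le> b" and b: "0 \<le> b"
  shows "(\<Sum>i<M. u i) - (\<Sum>i<M. u (i - \<tau>)) \<le> real \<tau> * b"
proof -
  have "(\<Sum>i<M. u i) = (\<Sum>i<M - \<tau>. u i) + (\<Sum>i\<in>{M - \<tau>..<M}. u i)"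
    by (simp add: lessThan_atLeast0 sum.atLeastLessThan_concat)
  then have "(\<Sum>i<M. u i) - (\<Sum>i<M. u (i - \<tau>)) = (\<Sum>i\<in>{M - \<tau>..<M}. u i)"
    by (simp add: sum_delayed[where u = u, OF assms(1)])
  also have "\<dots> \<le> real (card {M - \<tau>..<M}) * b"
    using u by (intro sum_bounded_above) auto
  also have "\<dots> \<le> real \<tau> * b" using b by (intro mult_right_mono) auto
  finally show ?thesis .
qed

locale td_learning = ergodic_chain K \<mu> \<kappa>0 \<rho>
  for K :: "'s::finite \<Rightarrow> 's pmf" and \<mu> \<kappa>0 \<rho> +
  fixes \<phi> :: "'s \<Rightarrow> real^'d" and r :: "'s \<Rightarrow> 's \<Rightarrow> real" and \<gamma> R \<alpha> :: real
  assumes feat: "\<And>s. norm (\<phi> s) \<le> 1" and gam: "0 \<le> \<gamma>" "\<gamma> < 1"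
    and nonsing: "invertible (A_e K \<mu> \<phi> \<gamma>)"
    and lam_pos: "lambda_A K \<mu> \<phi> \<gamma> > 0"
    and star_bd: "norm (theta_star K \<mu> \<phi> r \<gamma>) \<le> R"
    and alpha: "\<alpha> > 0"
begin

section \<open>Sampled and mean update operators, and the quadratic form\<close>

abbreviation A where "A \<equiv> A_e K \<mu> \<phi> \<gamma>"
abbreviation lam where "lam \<equiv> lambda_A K \<mu> \<phi> \<gamma>"
abbreviation th where "th \<equiv> theta_star K \<mu> \<phi> r \<gamma>"
abbreviation f where "f \<equiv> f_e K \<mu> \<phi> r \<gamma>"
abbreviation g where "g \<equiv> td_g r \<gamma> \<phi>"
abbreviation \<tau> where "\<tau> \<equiv> tau_mix \<kappa>0 \<rho> \<alpha>"

text \<open>Sampled and mean update directions are contracted by half the identity, which can be removed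
  from both without changing the noise; what remains has norm at most \<open>3/2\<close> instead of \<open>2\<close>.\<close>
definition sample_op :: "'s \<Rightarrow> 's \<Rightarrow> real^'d \<Rightarrow> real^'d" where
  "sample_op s s' y = ((\<phi> s - \<gamma> *\<^sub>R \<phi> s') \<bullet> y) *\<^sub>R \<phi> s - (1/2) *\<^sub>R y"

definition mean_op :: "real^'d \<Rightarrow> real^'d" where
  "mean_op y = A *v y - (1/2) *\<^sub>R y"

lemma R_nonneg: "0 \<le> R"
  using star_bd norm_ge_zero order_trans by blast

text \<open>The undiscounted part is a half reflection and contributes 1/2; the discounted part
  contributes at most 1.\<close>

lemma norm_sample_op_le: "norm (sample_op s s' y) \<le> 3/2 * norm y"
proof -
  have "norm ((\<gamma> * (\<phi> s' \<bullet> y)) *\<^sub>R \<phi> s) \<le> 1 * (1 * norm y) * 1"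
    unfolding norm_scaleR abs_mult
  proof (intro mult_mono)
    have "\<bar>\<phi> s' \<bullet> y\<bar> \<le> norm (\<phi> s') * norm y" by (rule Cauchy_Schwarz_ineq2)
    also have "\<dots> \<le> 1 * norm y" using feat by (intro mult_right_mono) auto
    finally show "\<bar>\<phi> s' \<bullet> y\<bar> \<le> 1 * norm y" .
  qed (use gam feat in auto)
  moreover have "sample_op s s' y
      = ((\<phi> s \<bullet> y) *\<^sub>R \<phi> s - (1/2) *\<^sub>R y) - (\<gamma> * (\<phi> s' \<bullet> y)) *\<^sub>R \<phi> s"
    by (simp add: sample_op_def inner_diff_left scaleR_diff_left)
  moreover have "norm ((\<phi> s \<bullet> y) *\<^sub>R \<phi> s - (1/2) *\<^sub>R y) \<le> norm y / 2"
    by (rule norm_reflection_half_le) (rule feat)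
  ultimately show ?thesis
    using norm_triangle_ineq4[of "(\<phi> s \<bullet> y) *\<^sub>R \<phi> s - (1/2) *\<^sub>R y" "(\<gamma> * (\<phi> s' \<bullet> y)) *\<^sub>R \<phi> s"]
    by simp
qed

lemma sample_op_diff: "sample_op s s' (x - y) = sample_op s s' x - sample_op s s' y"
  by (simp add: sample_op_def inner_diff_right scaleR_diff_left scaleR_diff_right)

lemma stat_mean_double_sum:
  "stat_mean W = (\<Sum>s\<in>UNIV. \<Sum>s'\<in>UNIV. (pmf \<mu> s * pmf (K s) s') *\<^sub>R W s s')"
  by (simp add: stat_mean_def expectation_finite_type scaleR_sum_right)

lemma A_mult: "A *v y = stat_mean (\<lambda>s s'. ((\<phi> s - \<gamma> *\<^sub>R \<phi> s') \<bullet> y) *\<^sub>R \<phi> s)"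
  unfolding A_e_def stat_mean_double_sum
  by (simp add: linear_sum[OF linear_matrix_vector_mult_left] scaleR_matrix_vector_assoc[symmetric]
      outer_mult_vector)

lemma b_e_stat_mean: "b_e K \<mu> \<phi> r = stat_mean (\<lambda>s s'. r s s' *\<^sub>R \<phi> s)"
  by (simp add: b_e_def stat_mean_double_sum)

lemma A_theta_star: "A *v th = b_e K \<mu> \<phi> r"
  unfolding theta_star_def matrix_vector_mul_assoc
  using someI_ex[OF nonsing[unfolded invertible_def]] by (simp add: matrix_inv_def)

lemma mean_op_stat_mean: "mean_op y = stat_mean (\<lambda>s s'. sample_op s s' y)"
  unfolding mean_op_def A_mult stat_mean_def sample_op_def by (simp add: expectation_linear)

lemma norm_mean_op_le: "norm (mean_op y) \<le> 3/2 * norm y"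
  unfolding mean_op_stat_mean by (intro norm_stat_mean_le norm_sample_op_le)

lemma g_eq: "g s s' \<theta> = r s s' *\<^sub>R \<phi> s - sample_op s s' \<theta> - (1/2) *\<^sub>R \<theta>"
  by (simp add: td_g_def sample_op_def inner_diff_left scaleR_add_left scaleR_diff_left)

lemma norm_g_shift_le:
  assumes "norm \<theta> \<le> R"
  shows "norm (g s s' \<theta> + (1/2) *\<^sub>R \<theta>) \<le> r_max r + 3/2 * R"
proof -
  have "norm (r s s' *\<^sub>R \<phi> s) \<le> r_max r * 1"
    unfolding norm_scaleR using abs_le_r_max feat r_max_nonneg by (intro mult_mono) auto
  moreover have "norm (sample_op s s' \<theta>) \<le> 3/2 * R"
    using norm_sample_op_le[of s s' \<theta>] assms by linarith
  ultimately show ?thesis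
    using norm_triangle_ineq4[of "r s s' *\<^sub>R \<phi> s" "sample_op s s' \<theta>"] by (simp add: g_eq)
qed

text \<open>Hence \<open>gm + A *v (\<theta>t - th)\<close> is the error of \<open>gm\<close> as an
  estimate of the mean direction at the snapshot.\<close>

lemma stat_mean_g: "stat_mean (\<lambda>s s'. g s s' \<theta>) = - (A *v (\<theta> - th))"
proof -
  have "stat_mean (\<lambda>s s'. g s s' \<theta>) = b_e K \<mu> \<phi> r - mean_op \<theta> - (1/2) *\<^sub>R \<theta>"
    unfolding g_eq b_e_stat_mean mean_op_stat_mean stat_mean_def by (simp add: expectation_linear)
  then show ?thesis
    by (simp add: mean_op_def A_theta_star[symmetric] matrix_vector_mult_diff_distrib)
qed

lemma f_eq: "f \<theta> = (\<theta> - th) \<bullet> (A *v (\<theta> - th))"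
  by (simp add: f_e_def Let_def)

text \<open>A quadratic form sees only the symmetric part of its matrix.\<close>

lemma lam_le_quadratic: "lam * (norm x)\<^sup>2 \<le> x \<bullet> (A *v x)"
proof -
  define S where "S = (1/2) *\<^sub>R (A + transpose A)"
  have "transpose S = S"
    by (simp add: S_def transpose_def vec_eq_iff)
  then have "min_eigenvalue S * (norm x)\<^sup>2 \<le> x \<bullet> (S *v x)"
    by (rule min_eigenvalue_le_quadratic_form)
  also have "x \<bullet> (S *v x) = (x \<bullet> (A *v x) + x \<bullet> (transpose A *v x)) / 2"
    by (simp add: S_def scaleR_matrix_vector_assoc[symmetric] matrix_vector_mult_add_rdistrib inner_add_right)
  also have "x \<bullet> (transpose A *v x) = x \<bullet> (A *v x)"
    by (metis dot_lmul_matrix inner_commute transpose_matrix_vector)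
  finally show ?thesis by (simp add: lambda_A_def S_def)
qed

text \<open>Adding back half of the identity turns the bound 3/2 for \<open>mean_op\<close> into 2.
  This yields \<open>lam \<le> 2\<close> and the bound of \<open>f\<close> on the ball.\<close>

lemma quadratic_le: "x \<bullet> (A *v x) \<le> 2 * (norm x)\<^sup>2"
proof -
  have "x \<bullet> (A *v x) = x \<bullet> mean_op x + (norm x)\<^sup>2 / 2"
    by (simp add: mean_op_def inner_diff_right power2_norm_eq_inner)
  also have "x \<bullet> mean_op x \<le> norm x * norm (mean_op x)" by (rule norm_cauchy_schwarz)
  also have "\<dots> \<le> norm x * (3/2 * norm x)" by (intro mult_left_mono norm_mean_op_le norm_ge_zero)
  finally show ?thesis by (simp add: power2_eq_square)
qed

lemma lam_le_2: "lam \<le> 2"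
proof -
  obtain x :: "real^'d" where x: "norm x = 1" using vector_choose_size[of 1] by auto
  show ?thesis using order_trans[OF lam_le_quadratic quadratic_le, of x] x by simp
qed

lemma lam_le_f: "lam * (norm (\<theta> - th))\<^sup>2 \<le> f \<theta>"
  unfolding f_eq by (rule lam_le_quadratic)

lemma f_nonneg: "0 \<le> f \<theta>"
  using lam_le_f[of \<theta>] lam_pos by (meson mult_nonneg_nonneg less_imp_le order_trans zero_le_power2)

lemma f_le:
  assumes "norm \<theta> \<le> R"
  shows "f \<theta> \<le> 8 * R\<^sup>2"
proof -
  have "norm (\<theta> - th) \<le> 2 * R" using norm_triangle_ineq4[of \<theta> th] assms star_bd by linarith
  then have "(norm (\<theta> - th))\<^sup>2 \<le> (2 * R)\<^sup>2" by (intro power_mono) auto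
  then show ?thesis unfolding f_eq using quadratic_le[of "\<theta> - th"] by (simp add: power_mult_distrib)
qed

lemma mix_tau_le: "mix \<tau> \<le> \<alpha>"
proof -
  \<comment> \<open>Some \<open>t\<close> must qualify before the \<open>LEAST\<close> in
    \<open>tau_mix\<close> can be unfolded to its property.\<close>
  have "(\<lambda>t. \<kappa>0 * \<rho> ^ t) \<longlonglongrightarrow> \<kappa>0 * 0"
    using rho by (intro tendsto_mult_left LIMSEQ_realpow_zero) auto
  then have "eventually (\<lambda>t. \<kappa>0 * \<rho> ^ t < \<alpha>) sequentially"
    using alpha by (intro order_tendstoD(2)) auto
  then obtain t where "\<kappa>0 * \<rho> ^ t \<le> \<alpha>"
    by (meson eventually_sequentially less_imp_le order_refl)
  then have "\<kappa>0 * \<rho> ^ \<tau> \<le> \<alpha>" unfolding tau_mix_def by (rule LeastI)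
  then show ?thesis by (simp add: mix_def)
qed

section \<open>The projected iteration as a function of the trajectory\<close>

definition td_step :: "real^'d \<Rightarrow> real^'d \<Rightarrow> 's \<Rightarrow> 's \<Rightarrow> real^'d \<Rightarrow> real^'d" where
  "td_step \<theta>t gm s s' \<theta> = proj_ball R (\<theta> + \<alpha> *\<^sub>R (g s s' \<theta> - g s s' \<theta>t + gm))"

text \<open>Given \<open>\<theta>t\<close> and \<open>gm\<close>, iterates are deterministic
  functions of the transitions. All randomness then sits in \<open>path_pmf\<close>, and iterate
  \<open>i\<close> depends on \<open>take i p\<close> only.\<close>

primrec td_iter :: "real^'d \<Rightarrow> real^'d \<Rightarrow> 's \<Rightarrow> real^'d \<Rightarrow> 's list \<Rightarrow> real^'d" where
  "td_iter \<theta>t gm s \<theta> [] = \<theta>"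
| "td_iter \<theta>t gm s \<theta> (s' # p) = td_iter \<theta>t gm s' (td_step \<theta>t gm s s' \<theta>) p"

lemma td_iter_take_Suc:
  "i < length p \<Longrightarrow> td_iter \<theta>t gm s \<theta> (take (Suc i) p)
    = td_step \<theta>t gm ((s # p) ! i) (p ! i) (td_iter \<theta>t gm s \<theta> (take i p))"
proof (induction p arbitrary: i s \<theta>)
  case (Cons s' p)
  then show ?case by (cases i) auto
qed simp

lemma norm_proj_ball_le: "norm (proj_ball R \<theta>) \<le> R"
  using closest_point_in_set[of "cball 0 R" \<theta>] R_nonneg by (simp add: proj_ball_def)

lemma norm_proj_ball_diff_le:
  assumes "norm \<eta> \<le> R"
  shows "norm (proj_ball R \<theta> - \<eta>) \<le> norm (\<theta> - \<eta>)"
  using closest_point_lipschitz[of "cball 0 R" \<theta> \<eta>] closest_point_self[of \<eta> "cball 0 R"] assms R_nonneg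
  by (simp add: proj_ball_def dist_norm)

lemma norm_td_iter_le: "norm \<theta> \<le> R \<Longrightarrow> norm (td_iter \<theta>t gm s \<theta> p) \<le> R"
  by (induction p arbitrary: s \<theta>) (auto simp: td_step_def norm_proj_ball_le)

text \<open>Each iterate is recorded before its transition, so the one produced by the last
  transition is absent from the list.\<close>

lemma td_inner_eq_path:
  "td_inner K r \<gamma> \<phi> R \<alpha> \<theta>t gm k s \<theta>
    = map_pmf (\<lambda>p. (map (\<lambda>i. td_iter \<theta>t gm s \<theta> (take i p)) [0..<k], last (s # p))) (path_pmf K k s)"
proof (induction k arbitrary: s \<theta>)
  case (Suc k)
  have upt: "[0..<Suc k] = 0 # map Suc [0..<k]"
    by (simp add: upt_conv_Cons map_Suc_upt del: upt_Suc)
  show ?case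
    by (simp add: Suc upt map_bind_pmf pmf.map_comp o_def td_step_def Let_def del: upt_Suc
        cong: map_pmf_cong)
qed simp

lemma td_est_eq_path:
  "td_est K r \<gamma> \<phi> \<theta> k s
    = map_pmf (\<lambda>p. (\<Sum>i<k. g ((s # p) ! i) (p ! i) \<theta>, last (s # p))) (path_pmf K k s)"
proof (induction k arbitrary: s)
  case (Suc k)
  show ?case
    by (simp add: Suc map_bind_pmf pmf.map_comp o_def sum.lessThan_Suc_shift del: sum.lessThan_Suc)
qed simp

end

subsection \<open>The inner loop\<close>

context td_learning
begin

lemma norm_diff_le:
  assumes "norm (x :: real^'d) \<le> R" "norm y \<le> R"
  shows "norm (x - y) \<le> 2 * R"
  using norm_triangle_ineq4[of x y] assms by linarith

text \<open>Regrouping the halves of the identity gives contributions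
  \<open>r_max r + 3/2 * R\<close> from the shifted \<open>gm\<close>, \<open>3 * R\<close> from
  \<open>sample_op\<close> and \<open>R / 2\<close> from the iterate.\<close>

lemma norm_direction_le:
  assumes \<theta>: "norm \<theta> \<le> R" "norm \<theta>t \<le> R" and gm: "norm (gm + (1/2) *\<^sub>R \<theta>t) \<le> r_max r + 3/2 * R"
  shows "norm (g s s' \<theta> - g s s' \<theta>t + gm) \<le> r_max r + 5 * R"
proof -
  have eq: "g s s' \<theta> - g s s' \<theta>t + gm
      = (gm + (1/2) *\<^sub>R \<theta>t) - (sample_op s s' (\<theta> - \<theta>t) + (1/2) *\<^sub>R \<theta>)"
    by (simp add: g_eq sample_op_diff algebra_simps)
  have "norm (sample_op s s' (\<theta> - \<theta>t)) \<le> 3/2 * (2 * R)"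
    using norm_sample_op_le[of s s' "\<theta> - \<theta>t"] norm_diff_le[OF \<theta>] by linarith
  then have "norm (sample_op s s' (\<theta> - \<theta>t) + (1/2) *\<^sub>R \<theta>) \<le> 3/2 * (2 * R) + R / 2"
    using norm_triangle_ineq[of "sample_op s s' (\<theta> - \<theta>t)" "(1/2) *\<^sub>R \<theta>"] \<theta> by simp
  then show ?thesis
    unfolding eq using norm_triangle_ineq4[of "gm + (1/2) *\<^sub>R \<theta>t"
        "sample_op s s' (\<theta> - \<theta>t) + (1/2) *\<^sub>R \<theta>"] gm by linarith
qed

lemma norm_td_step_diff_le:
  assumes "norm \<theta> \<le> R" "norm \<theta>t \<le> R" "norm (gm + (1/2) *\<^sub>R \<theta>t) \<le> r_max r + 3/2 * R"
  shows "norm (td_step \<theta>t gm s s' \<theta> - \<theta>) \<le> \<alpha> * (r_max r + 5 * R)"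
proof -
  have "norm (td_step \<theta>t gm s s' \<theta> - \<theta>) \<le> norm (\<alpha> *\<^sub>R (g s s' \<theta> - g s s' \<theta>t + gm))"
    unfolding td_step_def using norm_proj_ball_diff_le[OF assms(1)] by (metis add_diff_cancel_left')
  also have "\<dots> \<le> \<alpha> * (r_max r + 5 * R)"
    using norm_direction_le[OF assms] alpha by simp
  finally show ?thesis .
qed

text \<open>Projection does not increase the distance to \<open>th\<close>, which lies in the ball.
  The direction splits into mean descent, estimation error \<open>e\<close> and Markovian noise, in
  which the halves of the identity cancel.\<close>

lemma td_step_descent:
  assumes "norm \<theta> \<le> R" "norm \<theta>t \<le> R" "norm (gm + (1/2) *\<^sub>R \<theta>t) \<le> r_max r + 3/2 * R"
  defines "x \<equiv> \<theta> - th" and "y \<equiv> \<theta> - \<theta>t" and "e \<equiv> gm + A *v (\<theta>t - th)"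
  shows "(norm (td_step \<theta>t gm s s' \<theta> - th))\<^sup>2
    \<le> (norm x)\<^sup>2 + 2 * \<alpha> * (- f \<theta> + x \<bullet> e - x \<bullet> (sample_op s s' y - mean_op y))
      + \<alpha>\<^sup>2 * (r_max r + 5 * R)\<^sup>2"
proof -
  define v where "v = g s s' \<theta> - g s s' \<theta>t + gm"
  have "norm (td_step \<theta>t gm s s' \<theta> - th) \<le> norm (x + \<alpha> *\<^sub>R v)"
    unfolding td_step_def v_def[symmetric] x_def using norm_proj_ball_diff_le[OF star_bd]
    by (metis add_diff_eq add.commute)
  then have "(norm (td_step \<theta>t gm s s' \<theta> - th))\<^sup>2 \<le> (norm (x + \<alpha> *\<^sub>R v))\<^sup>2"
    by (rule power_mono) simp
  also have "\<dots> = (norm x)\<^sup>2 + 2 * \<alpha> * (x \<bullet> v) + \<alpha>\<^sup>2 * (norm v)\<^sup>2"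
    unfolding power2_norm_eq_inner
    by (simp add: inner_add inner_commute power2_eq_square algebra_simps)
  also have "x \<bullet> v = - f \<theta> + x \<bullet> e - x \<bullet> (sample_op s s' y - mean_op y)"
  proof -
    have "A *v y = A *v x - A *v (\<theta>t - th)"
      unfolding matrix_vector_mult_diff_distrib[symmetric] by (simp add: x_def y_def)
    then have "v = - (A *v x) + e - (sample_op s s' y - mean_op y)"
      by (simp add: v_def g_eq e_def y_def sample_op_diff mean_op_def algebra_simps)
    then show ?thesis
      by (simp add: f_eq x_def[symmetric] inner_add_right inner_diff_right)
  qed
  also have "\<alpha>\<^sup>2 * (norm v)\<^sup>2 \<le> \<alpha>\<^sup>2 * (r_max r + 5 * R)\<^sup>2"
    unfolding v_def using norm_direction_le[OF assms(1-3)] by (intro mult_left_mono power_mono) auto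
  finally show ?thesis by simp
qed

lemma norm_td_iter_drift_le:
  assumes "norm \<theta> \<le> R" "norm \<theta>t \<le> R" "norm (gm + (1/2) *\<^sub>R \<theta>t) \<le> r_max r + 3/2 * R"
    and "j \<le> i" "i \<le> length p"
  shows "norm (td_iter \<theta>t gm s \<theta> (take i p) - td_iter \<theta>t gm s \<theta> (take j p))
    \<le> real (i - j) * (\<alpha> * (r_max r + 5 * R))"
  using assms(4,5)
proof (induction i rule: dec_induct)
  case (step i)
  let ?t = "\<lambda>i. td_iter \<theta>t gm s \<theta> (take i p)"
  have "norm (?t (Suc i) - ?t i) \<le> \<alpha> * (r_max r + 5 * R)"
    using step.prems td_iter_take_Suc[of i p \<theta>t gm s \<theta>]
      norm_td_step_diff_le[OF norm_td_iter_le[OF assms(1)] assms(2,3)] by simp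
  moreover have "norm (?t i - ?t j) \<le> real (i - j) * (\<alpha> * (r_max r + 5 * R))"
    using step by simp
  moreover have "norm (?t (Suc i) - ?t j) \<le> norm (?t (Suc i) - ?t i) + norm (?t i - ?t j)"
    using norm_triangle_ineq[of "?t (Suc i) - ?t i" "?t i - ?t j"] by simp
  ultimately show ?case
    using step.hyps by (simp add: Suc_diff_le algebra_simps)
qed simp

text \<open>The arguments are exchanged one at a time, each at the price
  \<open>2 * R * (3/2 * d)\<close>.\<close>

lemma bilinear_drift_le:
  assumes L: "\<And>x y. L (x - y) = L x - L y" "\<And>y. norm (L y) \<le> 3/2 * norm y"
    and "norm x \<le> 2 * R" "norm y' \<le> 2 * R" "norm (x - x') \<le> d" "norm (y - y') \<le> d"
  shows "x' \<bullet> L y' - x \<bullet> L y \<le> 6 * R * d"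
proof -
  have "x' \<bullet> L y' - x \<bullet> L y = (x' - x) \<bullet> L y' + x \<bullet> L (y' - y)"
    by (simp add: L(1) inner_diff_left inner_diff_right)
  also have "(x' - x) \<bullet> L y' \<le> norm (x' - x) * norm (L y')" by (rule norm_cauchy_schwarz)
  also have "\<dots> \<le> d * (3/2 * (2 * R))"
    using assms(4,5) L(2)[of y'] R_nonneg order_trans[OF norm_ge_zero assms(5)]
    by (intro mult_mono) (auto simp: norm_minus_commute)
  also have "x \<bullet> L (y' - y) \<le> norm x * norm (L (y' - y))" by (rule norm_cauchy_schwarz)
  also have "\<dots> \<le> (2 * R) * (3/2 * d)"
    using assms(3,6) L(2)[of "y' - y"] R_nonneg by (intro mult_mono) (auto simp: norm_minus_commute)
  finally show ?thesis by simp
qed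

text \<open>The iterate is frozen \<open>\<tau>\<close> steps before the transition that drives the noise. Truncated subtraction
  freezes it at \<open>\<theta>t\<close>, where the noise vanishes, during the first \<open>\<tau>\<close> steps.\<close>
lemma expectation_delayed_noise_le:
  fixes s :: 's and gm :: "real^'d"
  assumes \<theta>t: "norm \<theta>t \<le> R" and i: "i < M"
  defines "\<theta> \<equiv> \<lambda>j p. td_iter \<theta>t gm s \<theta>t (take j p)"
  shows "measure_pmf.expectation (path_pmf K M s) (\<lambda>p. - ((\<theta> (i - \<tau>) p - th) \<bullet>
      (sample_op ((s # p) ! i) (p ! i) (\<theta> (i - \<tau>) p - \<theta>t) - mean_op (\<theta> (i - \<tau>) p - \<theta>t))))
    \<le> 12 * \<alpha> * R\<^sup>2"
proof -
  define j where "j = i - \<tau>"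
  define t where "t = (\<lambda>q. td_iter \<theta>t gm s \<theta>t q)"
  have tR: "norm (t q) \<le> R" for q unfolding t_def by (rule norm_td_iter_le) (rule \<theta>t)
  have "measure_pmf.expectation (path_pmf K M s) (\<lambda>p. - ((\<theta> j p - th) \<bullet>
      (sample_op ((s # p) ! i) (p ! i) (\<theta> j p - \<theta>t) - mean_op (\<theta> j p - \<theta>t))))
    = measure_pmf.expectation (path_pmf K j s) (\<lambda>q. - ((t q - th) \<bullet>
        (measure_pmf.expectation (chain_dist K (i - j) (last (s # q)))
          (\<lambda>u. measure_pmf.expectation (K u) (\<lambda>u'. sample_op u u' (t q - \<theta>t)))
         - mean_op (t q - \<theta>t))))"
    using expectation_path_prefix_transition[of j i M K s "\<lambda>q u u'. - ((t q - th) \<bullet>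
        (sample_op u u' (t q - \<theta>t) - mean_op (t q - \<theta>t)))"] i
    by (simp add: \<theta>_def t_def j_def expectation_linear expectation_inner_right_finite inner_diff_right
        del: last.simps)
  also have "\<dots> \<le> measure_pmf.expectation (path_pmf K j s) (\<lambda>q. 12 * \<alpha> * R\<^sup>2)"
  proof (rule expectation_mono_finite)
    fix q assume q: "q \<in> set_pmf (path_pmf K j s)"
    define D where "D = measure_pmf.expectation (chain_dist K (i - j) (last (s # q)))
          (\<lambda>u. measure_pmf.expectation (K u) (\<lambda>u'. sample_op u u' (t q - \<theta>t))) - mean_op (t q - \<theta>t)"
    have "norm D \<le> 6 * R * \<alpha>"
    proof (cases "\<tau> \<le> i")
      case True
      have "norm D \<le> 2 * (3/2 * norm (t q - \<theta>t)) * mix (i - j)"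
        unfolding D_def mean_op_stat_mean by (intro norm_mixing_le norm_sample_op_le)
      also have "\<dots> \<le> 2 * (3/2 * (2 * R)) * \<alpha>"
        using True mix_tau_le norm_diff_le[OF tR \<theta>t] mix_nonneg R_nonneg
        by (intro mult_mono) (auto simp: j_def)
      finally show ?thesis by simp
    next
      case False
      then have "q = []" using length_path_pmf[OF q] by (simp add: j_def)
      then have "t q - \<theta>t = 0" by (simp add: t_def)
      then have "D = 0"
        by (simp add: D_def sample_op_def mean_op_def)
      then show ?thesis using R_nonneg alpha by simp
    qed
    moreover have "- ((t q - th) \<bullet> D) \<le> norm (t q - th) * norm D"
      using Cauchy_Schwarz_ineq2[of "t q - th" D] by linarith
    moreover have "norm (t q - th) * norm D \<le> (2 * R) * (6 * R * \<alpha>)"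
      using calculation(1) norm_diff_le[OF tR star_bd] R_nonneg by (intro mult_mono) auto
    ultimately have "- ((t q - th) \<bullet> D) \<le> (2 * R) * (6 * R * \<alpha>)" by linarith
    then show "- ((t q - th) \<bullet> (measure_pmf.expectation (chain_dist K (i - j) (last (s # q)))
          (\<lambda>u. measure_pmf.expectation (K u) (\<lambda>u'. sample_op u u' (t q - \<theta>t))) - mean_op (t q - \<theta>t)))
        \<le> 12 * \<alpha> * R\<^sup>2"
      unfolding D_def[symmetric] by (simp add: power2_eq_square mult_ac)
  qed simp
  finally show ?thesis by (simp add: j_def)
qed

lemma path_descent:
  fixes s :: 's and p :: "'s list" and gm :: "real^'d"
  assumes \<theta>t: "norm \<theta>t \<le> R" and gm: "norm (gm + (1/2) *\<^sub>R \<theta>t) \<le> r_max r + 3/2 * R"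
    and c: "0 < c" and p: "length p = M"
  defines "W \<equiv> r_max r + 5 * R" and "e \<equiv> gm + A *v (\<theta>t - th)"
    and "\<theta> \<equiv> \<lambda>j. td_iter \<theta>t gm s \<theta>t (take j p)"
  defines "h \<equiv> \<lambda>i. - ((\<theta> (i - \<tau>) - th) \<bullet>
      (sample_op ((s # p) ! i) (p ! i) (\<theta> (i - \<tau>) - \<theta>t) - mean_op (\<theta> (i - \<tau>) - \<theta>t)))"
  shows "\<alpha> * (2 - c) * (\<Sum>i<M. f (\<theta> i)) \<le> (norm (\<theta>t - th))\<^sup>2
    + real M * (\<alpha> * (norm e)\<^sup>2 / (c * lam) + \<alpha>\<^sup>2 * W\<^sup>2 + 12 * \<alpha>\<^sup>2 * real \<tau> * R * W)
    + 12 * \<alpha> * real \<tau> * R\<^sup>2 + 2 * \<alpha> * (\<Sum>i<M. h i)"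
proof -
  define x where "x i = \<theta> i - th" for i
  define y where "y i = \<theta> i - \<theta>t" for i
  define u where "u i = x i \<bullet> mean_op (y i)" for i
  have \<theta>R: "norm (\<theta> i) \<le> R" for i
    unfolding \<theta>_def by (rule norm_td_iter_le) (rule \<theta>t)
  have xR: "norm (x i) \<le> 2 * R" and yR: "norm (y i) \<le> 2 * R" for i
    unfolding x_def y_def using norm_diff_le \<theta>R star_bd \<theta>t by auto
  have W: "0 \<le> W" using r_max_nonneg[of r] R_nonneg by (simp add: W_def)
  have young: "2 * (x i \<bullet> e) \<le> c * f (\<theta> i) + (norm e)\<^sup>2 / (c * lam)" for i
  proof -
    have cl: "0 < c * lam" using c lam_pos by simp
    have "0 \<le> (norm ((c * lam) *\<^sub>R x i - e))\<^sup>2 / (c * lam)" using cl by simp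
    also have "\<dots> = c * (lam * (norm (x i))\<^sup>2) - 2 * (x i \<bullet> e) + (norm e)\<^sup>2 / (c * lam)"
      using c lam_pos unfolding power2_norm_eq_inner
      by (simp add: inner_diff inner_commute field_simps)
    also have "c * (lam * (norm (x i))\<^sup>2) \<le> c * f (\<theta> i)"
      using c lam_le_f[of "\<theta> i"] by (simp add: x_def)
    finally show ?thesis by simp
  qed
  \<comment> \<open>Only the sampled part of the noise pays for drift; the change of the mean part
    is kept as \<open>u i - u (i - \<tau>)\<close> for the summation over \<open>i\<close>.\<close>
  have noise: "- (x i \<bullet> (sample_op ((s # p) ! i) (p ! i) (y i) - mean_op (y i)))
      \<le> h i + 6 * R * (real \<tau> * (\<alpha> * W)) + (u i - u (i - \<tau>))" if "i < M" for i
  proof -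
    define L where "L = sample_op ((s # p) ! i) (p ! i)"
    have "norm (\<theta> i - \<theta> (i - \<tau>)) \<le> real (i - (i - \<tau>)) * (\<alpha> * W)"
      unfolding \<theta>_def W_def using that p by (intro norm_td_iter_drift_le \<theta>t gm) auto
    also have "\<dots> \<le> real \<tau> * (\<alpha> * W)"
      using alpha W by (intro mult_right_mono) auto
    finally have drift: "norm (\<theta> i - \<theta> (i - \<tau>)) \<le> real \<tau> * (\<alpha> * W)" .
    have "x (i - \<tau>) \<bullet> L (y (i - \<tau>)) - x i \<bullet> L (y i) \<le> 6 * R * (real \<tau> * (\<alpha> * W))"
    proof (rule bilinear_drift_le[where L = L, OF _ _ xR yR])
      show "L (x - y) = L x - L y" and "norm (L y) \<le> 3/2 * norm y" for x y
        by (simp_all only: L_def sample_op_diff norm_sample_op_le)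
    qed (use drift in \<open>auto simp: x_def y_def\<close>)
    then show ?thesis
      by (simp add: h_def u_def L_def x_def[symmetric] y_def[symmetric] inner_diff_right)
  qed
  have step: "2 * \<alpha> * f (\<theta> i) \<le> (norm (x i))\<^sup>2 - (norm (x (Suc i)))\<^sup>2
      + \<alpha> * (c * f (\<theta> i) + (norm e)\<^sup>2 / (c * lam))
      + 2 * \<alpha> * (h i + 6 * R * (real \<tau> * (\<alpha> * W)) + (u i - u (i - \<tau>))) + \<alpha>\<^sup>2 * W\<^sup>2"
    if "i < M" for i
  proof -
    have "\<theta> (Suc i) = td_step \<theta>t gm ((s # p) ! i) (p ! i) (\<theta> i)"
      unfolding \<theta>_def using that p by (intro td_iter_take_Suc) simp
    then have "(norm (x (Suc i)))\<^sup>2 \<le> (norm (x i))\<^sup>2 + 2 * \<alpha> * (- f (\<theta> i) + x i \<bullet> e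
        - x i \<bullet> (sample_op ((s # p) ! i) (p ! i) (y i) - mean_op (y i))) + \<alpha>\<^sup>2 * W\<^sup>2"
      unfolding x_def y_def e_def W_def using td_step_descent[OF \<theta>R \<theta>t gm] by simp
    moreover have "\<alpha> * (2 * (x i \<bullet> e)) \<le> \<alpha> * (c * f (\<theta> i) + (norm e)\<^sup>2 / (c * lam))"
      using young alpha by (intro mult_left_mono) auto
    moreover have "2 * \<alpha> * - (x i \<bullet> (sample_op ((s # p) ! i) (p ! i) (y i) - mean_op (y i)))
        \<le> 2 * \<alpha> * (h i + 6 * R * (real \<tau> * (\<alpha> * W)) + (u i - u (i - \<tau>)))"
      using noise[OF that] alpha by (intro mult_left_mono) auto
    ultimately show ?thesis by (simp add: algebra_simps)
  qed
  have "2 * \<alpha> * (\<Sum>i<M. f (\<theta> i)) = (\<Sum>i<M. 2 * \<alpha> * f (\<theta> i))" by (simp add: sum_distrib_left)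
  also have "\<dots> \<le> (\<Sum>i<M. (norm (x i))\<^sup>2 - (norm (x (Suc i)))\<^sup>2
      + \<alpha> * (c * f (\<theta> i) + (norm e)\<^sup>2 / (c * lam))
      + 2 * \<alpha> * (h i + 6 * R * (real \<tau> * (\<alpha> * W)) + (u i - u (i - \<tau>))) + \<alpha>\<^sup>2 * W\<^sup>2)"
    using step by (intro sum_mono) auto
  also have "\<dots> = (norm (x 0))\<^sup>2 - (norm (x M))\<^sup>2 + \<alpha> * c * (\<Sum>i<M. f (\<theta> i))
      + real M * (\<alpha> * (norm e)\<^sup>2 / (c * lam) + \<alpha>\<^sup>2 * W\<^sup>2 + 12 * \<alpha>\<^sup>2 * real \<tau> * R * W)
      + 2 * \<alpha> * (\<Sum>i<M. h i) + 2 * \<alpha> * ((\<Sum>i<M. u i) - (\<Sum>i<M. u (i - \<tau>)))"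
  proof -
    have "(\<Sum>i<M. (norm (x i))\<^sup>2) - (\<Sum>i<M. (norm (x (Suc i)))\<^sup>2) = (norm (x 0))\<^sup>2 - (norm (x M))\<^sup>2"
      unfolding sum_subtractf[symmetric] by (rule sum_lessThan_telescope')
    then show ?thesis
      by (simp add: sum.distrib sum_subtractf sum_distrib_left algebra_simps power2_eq_square)
  qed
  \<comment> \<open>At most \<open>\<tau>\<close> boundary terms survive, each at most
    \<open>2 * R * (3/2 * (2 * R))\<close>; \<open>u 0\<close> vanishes because the loop starts at
    the snapshot.\<close>
  also have "2 * \<alpha> * ((\<Sum>i<M. u i) - (\<Sum>i<M. u (i - \<tau>))) \<le> 2 * \<alpha> * (real \<tau> * (6 * R\<^sup>2))"
  proof (intro mult_left_mono sum_minus_delayed_le)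
    show "u 0 = 0" by (simp add: u_def y_def \<theta>_def mean_op_def)
    fix i
    have "u i \<le> norm (x i) * norm (mean_op (y i))" unfolding u_def by (rule norm_cauchy_schwarz)
    also have "\<dots> \<le> (2 * R) * (3/2 * (2 * R))"
      using xR[of i] yR[of i] norm_mean_op_le[of "y i"] R_nonneg by (intro mult_mono) auto
    finally show "u i \<le> 6 * R\<^sup>2" by (simp add: power2_eq_square)
  qed (use alpha in auto)
  finally have "\<alpha> * (2 - c) * (\<Sum>i<M. f (\<theta> i)) \<le> (norm (x 0))\<^sup>2 - (norm (x M))\<^sup>2
    + real M * (\<alpha> * (norm e)\<^sup>2 / (c * lam) + \<alpha>\<^sup>2 * W\<^sup>2 + 12 * \<alpha>\<^sup>2 * real \<tau> * R * W)
    + 2 * \<alpha> * (\<Sum>i<M. h i) + 2 * \<alpha> * (real \<tau> * (6 * R\<^sup>2))"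
    by (simp add: left_diff_distrib right_diff_distrib)
  moreover have "(norm (x 0))\<^sup>2 - (norm (x M))\<^sup>2 \<le> (norm (\<theta>t - th))\<^sup>2"
    by (simp add: x_def \<theta>_def)
  moreover have "2 * \<alpha> * (real \<tau> * (6 * R\<^sup>2)) = 12 * \<alpha> * real \<tau> * R\<^sup>2" by simp
  ultimately show ?thesis by linarith
qed

text \<open>Division by \<open>\<alpha> * M\<close>. The step condition turns the initial squared
  distance into at most \<open>f \<theta>t / 2\<close>, and with \<open>lam \<le> 2\<close> the
  boundary terms, of order \<open>\<tau> / M\<close>, into order
  \<open>\<alpha> * \<tau>\<close>.\<close>

lemma inner_loop_descent:
  assumes \<theta>t: "norm \<theta>t \<le> R" and gm: "norm (gm + (1/2) *\<^sub>R \<theta>t) \<le> r_max r + 3/2 * R"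
    and c: "0 < c" and step: "\<alpha> * real M * lam = 2"
  defines "W \<equiv> r_max r + 5 * R" and "e \<equiv> gm + A *v (\<theta>t - th)"
  shows "(2 - c) * measure_pmf.expectation (path_pmf K M s)
      (\<lambda>p. (\<Sum>i<M. f (td_iter \<theta>t gm s \<theta>t (take i p))) / real M)
    \<le> f \<theta>t / 2 + (norm e)\<^sup>2 / (c * lam) + \<alpha> * (W\<^sup>2 + 24 * R\<^sup>2) + \<alpha> * real \<tau> * (12 * R * W + 12 * R\<^sup>2)"
proof -
  let ?E = "measure_pmf.expectation (path_pmf K M s)"
  define \<theta> where "\<theta> = (\<lambda>p j. td_iter \<theta>t gm s \<theta>t (take j p))"
  define h where "h = (\<lambda>p i. - ((\<theta> p (i - \<tau>) - th) \<bullet>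
      (sample_op ((s # p) ! i) (p ! i) (\<theta> p (i - \<tau>) - \<theta>t) - mean_op (\<theta> p (i - \<tau>) - \<theta>t))))"
  define C where "C = (norm (\<theta>t - th))\<^sup>2
    + real M * (\<alpha> * (norm e)\<^sup>2 / (c * lam) + \<alpha>\<^sup>2 * W\<^sup>2 + 12 * \<alpha>\<^sup>2 * real \<tau> * R * W)
    + 12 * \<alpha> * real \<tau> * R\<^sup>2"
  define F where "F = ?E (\<lambda>p. \<Sum>i<M. f (\<theta> p i))"
  have M: "0 < real M" using step by (cases M) auto
  have "\<alpha> * (2 - c) * F = ?E (\<lambda>p. \<alpha> * (2 - c) * (\<Sum>i<M. f (\<theta> p i)))" by (simp add: F_def)
  also have "\<dots> \<le> ?E (\<lambda>p. C + 2 * \<alpha> * (\<Sum>i<M. h p i))"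
    unfolding C_def h_def \<theta>_def W_def e_def
    by (intro expectation_mono_finite path_descent \<theta>t gm c finite_path_pmf) (rule length_path_pmf)
  also have "\<dots> = C + 2 * \<alpha> * (\<Sum>i<M. ?E (\<lambda>p. h p i))"
    by (simp add: expectation_linear expectation_sum_finite)
  also have "\<dots> \<le> C + 2 * \<alpha> * (real M * (12 * \<alpha> * R\<^sup>2))"
  proof -
    have "(\<Sum>i<M. ?E (\<lambda>p. h p i)) \<le> of_nat (card {..<M}) * (12 * \<alpha> * R\<^sup>2)"
      unfolding h_def \<theta>_def
      by (intro sum_bounded_above expectation_delayed_noise_le \<theta>t) auto
    then show ?thesis using alpha by (simp add: mult_ac)
  qed
  finally have "\<alpha> * (2 - c) * F \<le> C + 2 * \<alpha> * (real M * (12 * \<alpha> * R\<^sup>2))" .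
  then have "\<alpha> * (2 - c) * F / (\<alpha> * real M) \<le> (C + 2 * \<alpha> * (real M * (12 * \<alpha> * R\<^sup>2))) / (\<alpha> * real M)"
    using alpha M by (intro divide_right_mono) auto
  also have "\<dots> = (norm (\<theta>t - th))\<^sup>2 / (\<alpha> * real M) + (norm e)\<^sup>2 / (c * lam) + \<alpha> * (W\<^sup>2 + 24 * R\<^sup>2)
      + 12 * \<alpha> * real \<tau> * R * W + 12 * real \<tau> * R\<^sup>2 / real M"
    using alpha M c lam_pos by (simp add: C_def field_simps power2_eq_square)
  also have "(norm (\<theta>t - th))\<^sup>2 / (\<alpha> * real M) = lam * (norm (\<theta>t - th))\<^sup>2 / 2"
    using step alpha M by (simp add: field_simps)
  also have "\<dots> \<le> f \<theta>t / 2" using lam_le_f[of \<theta>t] by simp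
  also have "12 * real \<tau> * R\<^sup>2 / real M = 12 * real \<tau> * R\<^sup>2 * (\<alpha> * lam / 2)"
    using step M by (simp add: field_simps)
  also have "\<dots> \<le> 12 * real \<tau> * R\<^sup>2 * \<alpha>"
    using lam_le_2 alpha by (intro mult_left_mono) auto
  finally have "\<alpha> * (2 - c) * F / (\<alpha> * real M) \<le> f \<theta>t / 2 + (norm e)\<^sup>2 / (c * lam)
      + \<alpha> * (W\<^sup>2 + 24 * R\<^sup>2) + \<alpha> * real \<tau> * (12 * R * W + 12 * R\<^sup>2)"
    by (simp add: algebra_simps)
  moreover have "\<alpha> * (2 - c) * F / (\<alpha> * real M) = (2 - c) * ?E (\<lambda>p. (\<Sum>i<M. f (\<theta> p i)) / real M)"
    using alpha by (simp add: F_def)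
  ultimately show ?thesis by (simp add: \<theta>_def)
qed

end

subsection \<open>Epochs\<close>

text \<open>The allowance for the variance is \<open>8 * c * (2 - c) * (Q * k * n)\<close>, with
  factor 6 at \<open>c = 1/2\<close> and 8 at \<open>c = 1\<close>. Assumption \<open>nk\<close>
  forces \<open>n\<close> to be at least a multiple of \<open>k\<close> that grows with
  \<open>r / R\<close>.\<close>

lemma variance_budget:
  fixes R r n k :: real
  assumes R: "0 < R" and r: "0 \<le> r" and k: "1 \<le> k"
    and nk: "(4 * R\<^sup>2 + r\<^sup>2) * k \<le> 2 * R\<^sup>2 * n"
  defines "V \<equiv> (r + 3/2 * R)\<^sup>2 * (4 * n * k - n + 2 * k\<^sup>2 + 3 * k)"
    and "Q \<equiv> 4 * R\<^sup>2 + r\<^sup>2"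
  shows "r \<le> 3/5 * R \<Longrightarrow> V \<le> 6 * (Q * k * n)" and "V \<le> 8 * (Q * k * n)"
proof -
  have nk': "a * k \<le> n" if "2 * a * R\<^sup>2 \<le> Q" for a
  proof -
    have "2 * R\<^sup>2 * (a * k) \<le> Q * k"
      using mult_right_mono[OF that, of k] k by (simp add: mult_ac)
    then have "2 * R\<^sup>2 * (a * k) \<le> 2 * R\<^sup>2 * n" using nk by (simp add: Q_def)
    then show ?thesis using R by simp
  qed
  have n2: "2 * k \<le> n" by (rule nk') (simp add: Q_def)
  have kk: "k \<le> k * k" using k mult_right_mono[of 1 k k] by simp
  have nk0: "0 \<le> n * k" using n2 k by simp
  have V1: "V \<le> (11/2 * (r + 3/2 * R)\<^sup>2) * (k * n)"
  proof -
    have "2 * k * k \<le> n * k" using n2 k by (intro mult_right_mono) auto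
    \<comment> \<open>The constant is 4 + 1 + 1/2: \<open>2 * k\<^sup>2\<close> is at most
      \<open>n * k\<close>, and \<open>3 * k - n\<close> is at most \<open>k\<close>, hence at most
      half of \<open>n * k\<close>.\<close>
    then have "4 * n * k - n + 2 * k\<^sup>2 + 3 * k \<le> 11/2 * (k * n)"
      using n2 kk by (simp add: power2_eq_square algebra_simps)
    then have "V \<le> (r + 3/2 * R)\<^sup>2 * (11/2 * (k * n))"
      unfolding V_def by (intro mult_left_mono) auto
    then show ?thesis by (simp add: mult_ac)
  qed
  show "V \<le> 6 * (Q * k * n)" if "r \<le> 3/5 * R"
  proof -
    have "R * r \<le> R * (3/5 * R)" using R that by (intro mult_left_mono) auto
    moreover have "6 * Q - 11/2 * (r + 3/2 * R)\<^sup>2 = 93/8 * (R * R) - 33/2 * (R * r) + r * r / 2"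
      by (simp add: Q_def power2_eq_square algebra_simps)
    ultimately have "11/2 * (r + 3/2 * R)\<^sup>2 \<le> 6 * Q"
      using zero_le_square[of R] zero_le_square[of r] by linarith
    then have "(11/2 * (r + 3/2 * R)\<^sup>2) * (k * n) \<le> 6 * Q * (k * n)"
      using nk0 by (intro mult_right_mono) (auto simp: mult_ac)
    then show ?thesis using V1 by (simp add: mult_ac)
  qed
  show "V \<le> 8 * (Q * k * n)"
  proof (cases "r \<le> 3/2 * R")
    case True
    have "0 \<le> (3/2 * R - r) * (51/4 * R - 5/2 * r) + R\<^sup>2 / 2"
      using True R by (intro add_nonneg_nonneg mult_nonneg_nonneg) auto
    also have "\<dots> = 8 * Q - 11/2 * (r + 3/2 * R)\<^sup>2"
      by (simp add: Q_def power2_eq_square field_simps)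
    finally have "11/2 * (r + 3/2 * R)\<^sup>2 \<le> 8 * Q" by simp
    then have "(11/2 * (r + 3/2 * R)\<^sup>2) * (k * n) \<le> 8 * Q * (k * n)"
      using nk0 by (intro mult_right_mono) (auto simp: mult_ac)
    then show ?thesis using V1 by (simp add: mult_ac)
  next
    case False
    then have "(3/2 * R)\<^sup>2 \<le> r\<^sup>2" using R by (intro power_mono) auto
    moreover have "(3/2 * R)\<^sup>2 = 9/4 * R\<^sup>2" by (simp add: power_mult_distrib power_divide)
    ultimately have "2 * 3 * R\<^sup>2 \<le> Q" using zero_le_power2[of R] unfolding Q_def by linarith
    then have n3: "3 * k \<le> n" by (rule nk')
    have "3 * k * k \<le> n * k" using n3 k by (intro mult_right_mono) auto
    \<comment> \<open>With \<open>n \<ge> 3 * k\<close> the linear terms are nonpositive and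
      \<open>2 * k\<^sup>2\<close> is at most 2/3 of \<open>n * k\<close>.\<close>
    then have "4 * n * k - n + 2 * k\<^sup>2 + 3 * k \<le> 14/3 * (k * n)"
      using n3 by (simp add: power2_eq_square algebra_simps)
    \<comment> \<open>Cauchy-Schwarz for the vectors (1, 3/4) and (r, 2R), with 1 + 9/16 =
      25/16.\<close>
    moreover have "(r + 3/2 * R)\<^sup>2 \<le> 25/16 * Q"
      using zero_le_power2[of "2 * R - 3/4 * r"] by (simp add: Q_def power2_eq_square algebra_simps)
    ultimately have "V \<le> (25/16 * Q) * (14/3 * (k * n))"
      unfolding V_def using n3 k
      by (intro order_trans[OF mult_left_mono mult_right_mono]) (auto simp: nk0 mult.commute)
    also have "\<dots> = 175/24 * (Q * (k * n))" by simp
    finally have "V \<le> 175/24 * (Q * (k * n))" .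
    moreover have "0 \<le> Q * (k * n)" using nk0 by (simp add: Q_def mult.commute)
    ultimately show ?thesis by (simp add: mult_ac)
  qed
qed

text \<open>The factors 3/2 and 1 are \<open>2 - c\<close> at \<open>c = 1/2\<close> and
  \<open>c = 1\<close>. The second inequality is an equality at \<open>r = 0\<close>, which dictates
  the choice \<open>c = 1/2\<close> for small rewards.\<close>

lemma step_budget:
  fixes R r :: real
  assumes "0 \<le> R" "0 \<le> r"
  shows "(r + 5 * R)\<^sup>2 + 24 * R\<^sup>2 \<le> 3/2 * (8 * (r + 2 * R)\<^sup>2 + 9 * R\<^sup>2)"
    and "12 * R * (r + 5 * R) + 12 * R\<^sup>2 \<le> 3/2 * (12 * (r + 2 * R)\<^sup>2)"
    and "3/5 * R \<le> r \<Longrightarrow> (r + 5 * R)\<^sup>2 + 24 * R\<^sup>2 \<le> 8 * (r + 2 * R)\<^sup>2 + 9 * R\<^sup>2"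
    and "3/5 * R \<le> r \<Longrightarrow> 12 * R * (r + 5 * R) + 12 * R\<^sup>2 \<le> 12 * (r + 2 * R)\<^sup>2"
proof -
  have nn: "0 \<le> R * R" "0 \<le> R * r" "0 \<le> r * r" using assms by simp_all
  have "3/2 * (8 * (r + 2 * R)\<^sup>2 + 9 * R\<^sup>2) - ((r + 5 * R)\<^sup>2 + 24 * R\<^sup>2)
      = 11 * (r * r) + 38 * (R * r) + 25/2 * (R * R)"
    by (simp add: power2_eq_square field_simps)
  then show "(r + 5 * R)\<^sup>2 + 24 * R\<^sup>2 \<le> 3/2 * (8 * (r + 2 * R)\<^sup>2 + 9 * R\<^sup>2)"
    using nn by linarith
  have "3/2 * (12 * (r + 2 * R)\<^sup>2) - (12 * R * (r + 5 * R) + 12 * R\<^sup>2) = 18 * (r * r) + 60 * (R * r)"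
    by (simp add: power2_eq_square field_simps)
  then show "12 * R * (r + 5 * R) + 12 * R\<^sup>2 \<le> 3/2 * (12 * (r + 2 * R)\<^sup>2)"
    using nn by linarith
  assume r: "3/5 * R \<le> r"
  have large: "3/5 * (R * R) \<le> R * r" "3/5 * (R * r) \<le> r * r"
    using mult_left_mono[OF r assms(1)] mult_right_mono[OF r assms(2)] by simp_all
  have "8 * (r + 2 * R)\<^sup>2 + 9 * R\<^sup>2 - ((r + 5 * R)\<^sup>2 + 24 * R\<^sup>2)
      = 7 * (r * r) + 22 * (R * r) - 8 * (R * R)"
    by (simp add: power2_eq_square field_simps)
  then show "(r + 5 * R)\<^sup>2 + 24 * R\<^sup>2 \<le> 8 * (r + 2 * R)\<^sup>2 + 9 * R\<^sup>2"
    using nn large by linarith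
  have "12 * (r + 2 * R)\<^sup>2 - (12 * R * (r + 5 * R) + 12 * R\<^sup>2)
      = 12 * (r * r) + 36 * (R * r) - 24 * (R * R)"
    by (simp add: power2_eq_square field_simps)
  then show "12 * R * (r + 5 * R) + 12 * R\<^sup>2 \<le> 12 * (r + 2 * R)\<^sup>2"
    using nn large by linarith
qed

section \<open>One epoch\<close>

context td_learning
begin

definition estimate :: "real^'d \<Rightarrow> nat \<Rightarrow> 's \<Rightarrow> 's list \<Rightarrow> real^'d" where
  "estimate \<theta>t n s p = (1 / real n) *\<^sub>R (\<Sum>i<n. g ((s # p) ! i) (p ! i) \<theta>t)"

lemma norm_estimate_shift_le:
  assumes "norm \<theta>t \<le> R" and n: "1 \<le> n"
  shows "norm (estimate \<theta>t n s p + (1/2) *\<^sub>R \<theta>t) \<le> r_max r + 3/2 * R"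
proof -
  have "estimate \<theta>t n s p + (1/2) *\<^sub>R \<theta>t
      = (1 / real n) *\<^sub>R (\<Sum>i<n. g ((s # p) ! i) (p ! i) \<theta>t + (1/2) *\<^sub>R \<theta>t)"
    using n by (simp add: estimate_def sum.distrib scaleR_add_right sum_constant_scaleR del: sum_constant)
  also have "norm \<dots> \<le> (1 / real n) * (\<Sum>i<n. r_max r + 3/2 * R)"
    unfolding norm_scaleR using assms(1)
    by (intro mult_mono sum_norm_le norm_g_shift_le) (auto simp: r_max_nonneg R_nonneg)
  also have "\<dots> = r_max r + 3/2 * R" using n by simp
  finally show ?thesis .
qed

text \<open>The constant shift by half of \<open>\<theta>t\<close> cancels against its own mean, so
  the variance bound applies with the smaller bound of the shifted directions.\<close>

lemma estimate_variance_le: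
  assumes "norm \<theta>t \<le> R" and n: "1 \<le> n"
  defines "k \<equiv> 1 + K_mix"
  shows "measure_pmf.expectation (path_pmf K n s)
      (\<lambda>p. (norm (estimate \<theta>t n s p + A *v (\<theta>t - th)))\<^sup>2)
    \<le> (r_max r + 3/2 * R)\<^sup>2 * (4 * real n * k - real n + 2 * k\<^sup>2 + 3 * k) / (real n)\<^sup>2"
proof -
  define W where "W = (\<lambda>s s'. g s s' \<theta>t + (1/2) *\<^sub>R \<theta>t)"
  have mean: "stat_mean W = (1/2) *\<^sub>R \<theta>t - A *v (\<theta>t - th)"
  proof -
    have "stat_mean W = stat_mean (\<lambda>s s'. g s s' \<theta>t) + (1/2) *\<^sub>R \<theta>t"
      unfolding W_def stat_mean_def by (simp add: expectation_linear)
    then show ?thesis by (simp add: stat_mean_g)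
  qed
  have "estimate \<theta>t n s p + A *v (\<theta>t - th)
      = (1 / real n) *\<^sub>R (\<Sum>i<n. W ((s # p) ! i) (p ! i) - stat_mean W)" for p
    unfolding mean using n
    by (simp add: estimate_def W_def sum.distrib scaleR_add_right sum_constant_scaleR del: sum_constant)
  then have "measure_pmf.expectation (path_pmf K n s)
      (\<lambda>p. (norm (estimate \<theta>t n s p + A *v (\<theta>t - th)))\<^sup>2)
    = measure_pmf.expectation (path_pmf K n s)
      (\<lambda>p. (norm (\<Sum>i<n. W ((s # p) ! i) (p ! i) - stat_mean W))\<^sup>2) / (real n)\<^sup>2"
    by (simp add: power_mult_distrib power_divide)
  also have "\<dots> \<le> (r_max r + 3/2 * R)\<^sup>2 * (4 * real n * k - real n + 2 * k\<^sup>2 + 3 * k) / (real n)\<^sup>2"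
    unfolding k_def W_def
    by (intro divide_right_mono trajectory_variance_le norm_g_shift_le assms(1) n) simp
  finally show ?thesis .
qed

lemma td_epoch_eq_path:
  "td_epoch K r \<gamma> \<phi> R \<alpha> M n (s, \<theta>t) = bind_pmf (path_pmf K n s) (\<lambda>p.
     bind_pmf (path_pmf K M (last (s # p))) (\<lambda>p'. map_pmf (\<lambda>i. (last (last (s # p) # p'),
       map (\<lambda>i. td_iter \<theta>t (estimate \<theta>t n s p) (last (s # p)) \<theta>t (take i p')) [0..<M] ! i))
       (pmf_of_set {..<M})))"
  by (simp add: td_epoch_def td_est_eq_path td_inner_eq_path bind_map_pmf Let_def estimate_def
      del: last.simps)

lemma td_epoch_support:
  assumes M: "1 \<le> M" and \<theta>t: "norm \<theta>t \<le> R"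
  shows "finite (set_pmf (td_epoch K r \<gamma> \<phi> R \<alpha> M n (s, \<theta>t)))"
    and "x \<in> set_pmf (td_epoch K r \<gamma> \<phi> R \<alpha> M n (s, \<theta>t)) \<Longrightarrow> norm (snd x) \<le> R"
proof -
  have ne: "{..<M} \<noteq> {}" using M by (auto simp: lessThan_empty_iff)
  show "finite (set_pmf (td_epoch K r \<gamma> \<phi> R \<alpha> M n (s, \<theta>t)))"
    using ne by (simp add: td_epoch_eq_path del: last.simps)
  show "norm (snd x) \<le> R" if "x \<in> set_pmf (td_epoch K r \<gamma> \<phi> R \<alpha> M n (s, \<theta>t))"
    using that ne norm_td_iter_le[OF \<theta>t] by (auto simp: td_epoch_eq_path simp del: last.simps)
qed

lemma expectation_td_epoch:
  assumes M: "1 \<le> M"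
  shows "measure_pmf.expectation (td_epoch K r \<gamma> \<phi> R \<alpha> M n (s, \<theta>t)) (\<lambda>x. h (snd x) :: real)
    = measure_pmf.expectation (path_pmf K n s) (\<lambda>p.
        measure_pmf.expectation (path_pmf K M (last (s # p))) (\<lambda>p'.
          (\<Sum>i<M. h (td_iter \<theta>t (estimate \<theta>t n s p) (last (s # p)) \<theta>t (take i p'))) / real M))"
proof -
  have ne: "{..<M} \<noteq> {}" using M by (auto simp: lessThan_empty_iff)
  show ?thesis
    using ne by (simp add: td_epoch_eq_path expectation_bind_pmf_finite integral_pmf_of_set
        del: last.simps)
qed

text \<open>A quarter of the additive term in the final bound: errors accumulate over the epochs
  with total weight at most 1 / (1 - 3/4) = 4.\<close>

definition epoch_error :: "nat \<Rightarrow> real" where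
  "epoch_error n = 8 * ((4 * R\<^sup>2 + (r_max r)\<^sup>2) * (1 + K_mix)) / (lam * real n)
    + \<alpha> * (8 * (r_max r + 2 * R)\<^sup>2 + 9 * R\<^sup>2) + \<alpha> * real \<tau> * (12 * (r_max r + 2 * R)\<^sup>2)"

lemma epoch_error_nonneg: "0 \<le> epoch_error n"
  unfolding epoch_error_def using K_mix_nonneg lam_pos alpha
  by (intro add_nonneg_nonneg divide_nonneg_nonneg mult_nonneg_nonneg) auto

text \<open>\<open>c\<close> is the weight in Young's inequality: a small \<open>c\<close> leaves more room for the noise of the inner
  loop and less for the variance of the estimate.\<close>
lemma td_epoch_contraction_weighted:
  assumes \<theta>t: "norm \<theta>t \<le> R" and n: "1 \<le> n" and M: "1 \<le> M" and step: "\<alpha> * real M * lam = 2"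
    and c: "0 < c" "c \<le> 1"
  defines "W \<equiv> r_max r + 5 * R" and "G \<equiv> r_max r + 2 * R" and "k \<equiv> 1 + K_mix"
  assumes variance: "(r_max r + 3/2 * R)\<^sup>2 * (4 * real n * k - real n + 2 * k\<^sup>2 + 3 * k)
        \<le> 8 * c * (2 - c) * ((4 * R\<^sup>2 + (r_max r)\<^sup>2) * k * real n)"
    and square: "W\<^sup>2 + 24 * R\<^sup>2 \<le> (2 - c) * (8 * G\<^sup>2 + 9 * R\<^sup>2)"
    and drift: "12 * R * W + 12 * R\<^sup>2 \<le> (2 - c) * (12 * G\<^sup>2)"
  shows "measure_pmf.expectation (td_epoch K r \<gamma> \<phi> R \<alpha> M n (s, \<theta>t)) (\<lambda>x. f (snd x))
    \<le> 3/4 * f \<theta>t + epoch_error n"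
proof -
  let ?E = "measure_pmf.expectation (path_pmf K n s)"
  define Q where "Q = 4 * R\<^sup>2 + (r_max r)\<^sup>2"
  define F where "F = measure_pmf.expectation (td_epoch K r \<gamma> \<phi> R \<alpha> M n (s, \<theta>t)) (\<lambda>x. f (snd x))"
  define D where "D = f \<theta>t / 2 + \<alpha> * (W\<^sup>2 + 24 * R\<^sup>2) + \<alpha> * real \<tau> * (12 * R * W + 12 * R\<^sup>2)"
  define e where "e = (\<lambda>p. estimate \<theta>t n s p + A *v (\<theta>t - th))"
  have n0: "0 < real n" using n by simp
  have "(2 - c) * F = ?E (\<lambda>p. (2 - c) * measure_pmf.expectation (path_pmf K M (last (s # p))) (\<lambda>p'.
      (\<Sum>i<M. f (td_iter \<theta>t (estimate \<theta>t n s p) (last (s # p)) \<theta>t (take i p'))) / real M))"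
    by (simp add: F_def expectation_td_epoch[OF M] del: last.simps)
  also have "\<dots> \<le> ?E (\<lambda>p. D + (norm (e p))\<^sup>2 / (c * lam))"
  proof (rule expectation_mono_finite)
    fix p
    show "(2 - c) * measure_pmf.expectation (path_pmf K M (last (s # p))) (\<lambda>p'.
          (\<Sum>i<M. f (td_iter \<theta>t (estimate \<theta>t n s p) (last (s # p)) \<theta>t (take i p'))) / real M)
        \<le> D + (norm (e p))\<^sup>2 / (c * lam)"
      using inner_loop_descent[OF \<theta>t norm_estimate_shift_le[OF \<theta>t n, of s p] c(1) step, of "last (s # p)"]
      unfolding D_def e_def W_def by linarith
  qed simp
  also have "\<dots> = D + ?E (\<lambda>p. (norm (e p))\<^sup>2) / (c * lam)"
    by (simp add: expectation_linear)
  also have "?E (\<lambda>p. (norm (e p))\<^sup>2) / (c * lam)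
      \<le> (8 * c * (2 - c) * (Q * k * real n) / (real n)\<^sup>2) / (c * lam)"
  proof -
    have "?E (\<lambda>p. (norm (e p))\<^sup>2) \<le> 8 * c * (2 - c) * (Q * k * real n) / (real n)\<^sup>2"
      using order_trans[OF estimate_variance_le[OF \<theta>t n] divide_right_mono[OF variance[unfolded k_def]]]
      by (simp add: e_def Q_def k_def)
    then show ?thesis using c lam_pos by (intro divide_right_mono) auto
  qed
  \<comment> \<open>The form \<open>8 * c * (2 - c)\<close> of the variance allowance makes
    \<open>c\<close> cancel here and leaves the common factor \<open>2 - c\<close>.\<close>
  also have "\<dots> = (2 - c) * (8 * (Q * k) / (lam * real n))"
    using c lam_pos n0 by (simp add: power2_eq_square mult_ac)
  finally have "(2 - c) * F \<le> D + (2 - c) * (8 * (Q * k) / (lam * real n))" by simp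
  also have "\<dots> \<le> (2 - c) * (3/4 * f \<theta>t) + \<alpha> * ((2 - c) * (8 * G\<^sup>2 + 9 * R\<^sup>2))
      + \<alpha> * real \<tau> * ((2 - c) * (12 * G\<^sup>2)) + (2 - c) * (8 * (Q * k) / (lam * real n))"
  proof -
    have "f \<theta>t / 2 \<le> (2 - c) * (3/4 * f \<theta>t)"
      using mult_right_mono[of 1 "2 - c" "3/4 * f \<theta>t"] c f_nonneg[of \<theta>t] by linarith
    then show ?thesis
      unfolding D_def using square drift alpha c lam_pos by (intro add_mono mult_left_mono) auto
  qed
  also have "\<dots> = (2 - c) * (3/4 * f \<theta>t + epoch_error n)"
    by (simp add: epoch_error_def Q_def k_def G_def algebra_simps)
  finally show ?thesis using c by (simp add: F_def)
qed

text \<open>For \<open>n\<close> large there are two weights. Small rewards leave slack in the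
  variance but little in the drift, so \<open>c = 1/2\<close>; larger rewards raise \<open>G\<close>
  and permit \<open>c = 1\<close>. At the threshold 3/5 both sets of inequalities hold.\<close>

lemma td_epoch_contraction:
  assumes \<theta>t: "norm \<theta>t \<le> R" and n: "1 \<le> n" and M: "1 \<le> M" and step: "\<alpha> * real M * lam = 2"
  shows "measure_pmf.expectation (td_epoch K r \<gamma> \<phi> R \<alpha> M n (s, \<theta>t)) (\<lambda>x. f (snd x))
    \<le> 3/4 * f \<theta>t + epoch_error n"
proof -
  define Q where "Q = 4 * R\<^sup>2 + (r_max r)\<^sup>2"
  define k where "k = 1 + K_mix"
  note support = td_epoch_support[OF M \<theta>t, where n = n and s = s]
  have ln: "0 < lam * real n" using lam_pos n by simp
  have r: "0 \<le> r_max r" by (rule r_max_nonneg)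
  show ?thesis
  proof (cases "R\<^sup>2 * (lam * real n) \<le> Q * k")
    \<comment> \<open>The error term alone dominates \<open>f\<close> on the ball. Otherwise \<open>n\<close> is at least \<open>2 * k\<close>, so that
      the variance has outlived its transient phase.\<close>
    case True
    have "8 * R\<^sup>2 \<le> 8 * (Q * k) / (lam * real n)"
      using True ln by (simp add: pos_le_divide_eq)
    also have "\<dots> \<le> epoch_error n"
      using alpha by (simp add: epoch_error_def Q_def k_def)
    finally have "f (snd x) \<le> epoch_error n" if "x \<in> set_pmf (td_epoch K r \<gamma> \<phi> R \<alpha> M n (s, \<theta>t))" for x
      using f_le[OF support(2)[OF that]] by linarith
    then have "measure_pmf.expectation (td_epoch K r \<gamma> \<phi> R \<alpha> M n (s, \<theta>t)) (\<lambda>x. f (snd x))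
        \<le> measure_pmf.expectation (td_epoch K r \<gamma> \<phi> R \<alpha> M n (s, \<theta>t)) (\<lambda>x. epoch_error n)"
      by (rule expectation_mono_finite[OF support(1)])
    then show ?thesis using f_nonneg[of \<theta>t] by simp
  next
    case False
    have k: "1 \<le> k" using K_mix_nonneg by (simp add: k_def)
    have "0 \<le> Q * k" using k by (simp add: Q_def)
    with False have "R \<noteq> 0" by auto
    then have R: "0 < R" using R_nonneg by simp
    have "R\<^sup>2 * (lam * real n) \<le> R\<^sup>2 * (2 * real n)"
      using lam_le_2 by (intro mult_left_mono mult_right_mono) auto
    \<comment> \<open>Bounding \<open>lam\<close> by 2 leaves a relation between \<open>n\<close>
      and \<open>k\<close> alone, up to \<open>R\<close> and \<open>Q\<close>, as the variance
      budget requires.\<close>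
    then have nk: "Q * k \<le> 2 * R\<^sup>2 * real n" using False by simp
    note budget = variance_budget[OF R r k nk[unfolded Q_def]]
    show ?thesis
    proof (cases "r_max r \<le> 3/5 * R")
      case True
      show ?thesis
      proof (rule td_epoch_contraction_weighted[OF \<theta>t n M step, of "1/2"])
        show "(r_max r + 3/2 * R)\<^sup>2 * (4 * real n * (1 + K_mix) - real n + 2 * (1 + K_mix)\<^sup>2 + 3 * (1 + K_mix))
          \<le> 8 * (1/2) * (2 - 1/2) * ((4 * R\<^sup>2 + (r_max r)\<^sup>2) * (1 + K_mix) * real n)"
          using budget(1)[OF True] by (simp add: k_def)
        show "(r_max r + 5 * R)\<^sup>2 + 24 * R\<^sup>2 \<le> (2 - 1/2) * (8 * (r_max r + 2 * R)\<^sup>2 + 9 * R\<^sup>2)"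
          "12 * R * (r_max r + 5 * R) + 12 * R\<^sup>2 \<le> (2 - 1/2) * (12 * (r_max r + 2 * R)\<^sup>2)"
          using step_budget(1,2)[OF R_nonneg r] by simp_all
      qed auto
    next
      case False
      show ?thesis
      proof (rule td_epoch_contraction_weighted[OF \<theta>t n M step, of 1])
        show "(r_max r + 3/2 * R)\<^sup>2 * (4 * real n * (1 + K_mix) - real n + 2 * (1 + K_mix)\<^sup>2 + 3 * (1 + K_mix))
          \<le> 8 * 1 * (2 - 1) * ((4 * R\<^sup>2 + (r_max r)\<^sup>2) * (1 + K_mix) * real n)"
          using budget(2) by (simp add: k_def)
        show "(r_max r + 5 * R)\<^sup>2 + 24 * R\<^sup>2 \<le> (2 - 1) * (8 * (r_max r + 2 * R)\<^sup>2 + 9 * R\<^sup>2)"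
          "12 * R * (r_max r + 5 * R) + 12 * R\<^sup>2 \<le> (2 - 1) * (12 * (r_max r + 2 * R)\<^sup>2)"
          using step_budget(3,4)[OF R_nonneg r] False by simp_all
      qed auto
    qed
  qed
qed

section \<open>Iterating the epochs\<close>

lemma td_run_Suc:
  "td_run K r \<gamma> \<phi> R \<alpha> M n \<nu> \<theta>0 (Suc m)
    = bind_pmf (td_run K r \<gamma> \<phi> R \<alpha> M n \<nu> \<theta>0 m) (td_epoch K r \<gamma> \<phi> R \<alpha> M n)"
  by (simp add: td_run_def)

lemma td_run_support:
  assumes M: "1 \<le> M" and init: "norm \<theta>0 \<le> R"
  shows "finite (set_pmf (td_run K r \<gamma> \<phi> R \<alpha> M n \<nu> \<theta>0 m))
    \<and> (\<forall>x\<in>set_pmf (td_run K r \<gamma> \<phi> R \<alpha> M n \<nu> \<theta>0 m). norm (snd x) \<le> R)"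
proof (induction m)
  case 0
  show ?case using init by (auto simp: td_run_def)
next
  case (Suc m)
  then show ?case
    using td_epoch_support[OF M] unfolding td_run_Suc by fastforce
qed

text \<open>The number \<open>4 * epoch_error n\<close> is the fixed point of the recursion with
  factor 3/4 and increment \<open>epoch_error n\<close>.\<close>

lemma td_run_bound:
  assumes n: "1 \<le> n" and M: "1 \<le> M" and step: "\<alpha> * real M * lam = 2" and init: "norm \<theta>0 \<le> R"
  shows "measure_pmf.expectation (td_run K r \<gamma> \<phi> R \<alpha> M n \<nu> \<theta>0 m) (\<lambda>x. f (snd x))
    \<le> (3/4) ^ m * f \<theta>0 + 4 * epoch_error n"
proof (induction m)
  case 0
  show ?case using epoch_error_nonneg by (simp add: td_run_def)
next
  case (Suc m)
  let ?p = "td_run K r \<gamma> \<phi> R \<alpha> M n \<nu> \<theta>0 m"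
  have fin: "finite (set_pmf ?p)" and R: "\<And>x. x \<in> set_pmf ?p \<Longrightarrow> norm (snd x) \<le> R"
    using td_run_support[OF M init, of n \<nu> m] by auto
  have "measure_pmf.expectation (td_run K r \<gamma> \<phi> R \<alpha> M n \<nu> \<theta>0 (Suc m)) (\<lambda>x. f (snd x))
      = measure_pmf.expectation ?p (\<lambda>x. measure_pmf.expectation (td_epoch K r \<gamma> \<phi> R \<alpha> M n x) (\<lambda>x. f (snd x)))"
    unfolding td_run_Suc
    by (rule expectation_bind_pmf_finite[OF fin]) (metis R td_epoch_support(1)[OF M] prod.collapse)
  also have "\<dots> \<le> measure_pmf.expectation ?p (\<lambda>x. 3/4 * f (snd x) + epoch_error n)"
  proof (rule expectation_mono_finite[OF fin])
    fix x assume "x \<in> set_pmf ?p"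
    then show "measure_pmf.expectation (td_epoch K r \<gamma> \<phi> R \<alpha> M n x) (\<lambda>x. f (snd x))
        \<le> 3/4 * f (snd x) + epoch_error n"
      using td_epoch_contraction[OF R n M step, of x "fst x"] by simp
  qed
  also have "\<dots> = 3/4 * measure_pmf.expectation ?p (\<lambda>x. f (snd x)) + epoch_error n"
    by (simp add: expectation_linear fin)
  also have "\<dots> \<le> 3/4 * ((3/4) ^ m * f \<theta>0 + 4 * epoch_error n) + epoch_error n"
    using Suc by simp
  finally show ?case by (simp add: field_simps)
qed

end

theorem theorem3:
  fixes K :: "'s::finite \<Rightarrow> 's pmf" and \<mu> :: "'s pmf"
    and \<phi> :: "'s \<Rightarrow> real^'d" and r :: "'s \<Rightarrow> 's \<Rightarrow> real" and \<gamma> :: real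
    and R \<alpha> \<kappa>0 \<rho> :: real and M n :: nat and \<nu> :: "'s pmf" and \<theta>0 :: "real^'d"
  assumes irred: "irreducible_chain K" and aper: "aperiodic_chain K"
    and stat: "stationary_dist K \<mu>"
    and feat: "\<And>s. norm (\<phi> s) \<le> 1"
    and gam: "0 \<le> \<gamma>" "\<gamma> < 1"
    and nonsing: "invertible (A_e K \<mu> \<phi> \<gamma>)"
    and lam_pos: "lambda_A K \<mu> \<phi> \<gamma> > 0"
    and star_bd: "norm (theta_star K \<mu> \<phi> r \<gamma>) \<le> R"
    and kappa: "\<kappa>0 > 0" and rho: "0 < \<rho>" "\<rho> < 1"
    and ergodic: "\<And>t s. tv_dist (chain_dist K t s) \<mu> \<le> \<kappa>0 * \<rho> ^ t"
    and alpha: "\<alpha> > 0" and M: "M \<ge> 1" and n: "n \<ge> 1"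
    and step: "\<alpha> * real M * lambda_A K \<mu> \<phi> \<gamma> = 2"
    and init: "norm \<theta>0 \<le> R"
  shows "measure_pmf.expectation (td_run K r \<gamma> \<phi> R \<alpha> M n \<nu> \<theta>0 m)
            (\<lambda>(s, \<theta>). f_e K \<mu> \<phi> r \<gamma> \<theta>)
         \<le> (3/4) ^ m * f_e K \<mu> \<phi> r \<gamma> \<theta>0
           + 8 * (4 * (1 + (\<kappa>0 - 1) * \<rho>) / (1 - \<rho>) * (4 * R\<^sup>2 + (r_max r)\<^sup>2))
               / (lambda_A K \<mu> \<phi> \<gamma> * real n)
           + 4 * \<alpha> * (2 * (r_max r + 2 * R)\<^sup>2 * (4 + 6 * real (tau_mix \<kappa>0 \<rho> \<alpha>))
                        + 9 * R\<^sup>2)"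
proof -
  interpret td_learning K \<mu> \<kappa>0 \<rho> \<phi> r \<gamma> R \<alpha>
    by unfold_locales (fact stat kappa rho ergodic feat gam nonsing lam_pos star_bd alpha)+
  \<comment> \<open>Identifies the mixing factor of the variance bound with the one in
    \<open>C_2\<close>.\<close>
  have "1 + K_mix = (1 + (\<kappa>0 - 1) * \<rho>) / (1 - \<rho>)"
    using rho by (simp add: K_mix_def field_simps)
  then have "4 * (1 + (\<kappa>0 - 1) * \<rho>) / (1 - \<rho>) * (4 * R\<^sup>2 + (r_max r)\<^sup>2)
      = 4 * ((4 * R\<^sup>2 + (r_max r)\<^sup>2) * (1 + K_mix))"
    by simp
  then have "4 * epoch_error n
      = 8 * (4 * (1 + (\<kappa>0 - 1) * \<rho>) / (1 - \<rho>) * (4 * R\<^sup>2 + (r_max r)\<^sup>2))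
               / (lambda_A K \<mu> \<phi> \<gamma> * real n)
           + 4 * \<alpha> * (2 * (r_max r + 2 * R)\<^sup>2 * (4 + 6 * real (tau_mix \<kappa>0 \<rho> \<alpha>))
                        + 9 * R\<^sup>2)"
    unfolding epoch_error_def by (simp only: distrib_left) (simp add: algebra_simps)
  then show ?thesis
    using td_run_bound[OF n M step init, of \<nu> m] by (simp add: case_prod_unfold)
qed

end
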